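(* Let $G$ be a connected graph of order at least 3. Then $G$ is a minimal DPDP-graph if and only if $G=S_2(H)$ for some connected graph $H$ (and some function $\alpha$), and either $(V^o_{S_2(H)},V^n_{S_2(H)})$ is the only DP-pair in $S_2(H)$, or $S_2(H)$ is a cycle of length 3, 6 or 9.
   Context: Graphs are finite and may have multiple edges and loops. A leaf is a vertex of degree one. A set $D\subseteq V(G)$ is dominating if every vertex outside $D$ has a neighbor in $D$; $P$ is paired-dominating if it is dominating and the subgraph induced by $P$ has a perfect matching. A DP-pair of $G$ is a pair $(D,P)$ of disjoint sets with $V(G)=D\cup P$, $D$ dominating and $P$ paired-dominating. A DPDP-graph is a graph with a DP-pair; a minimal DPDP-graph is a DPDP-graph no proper spanning subgraph of which is a DPDP-graph. 2-subdivision graph: for a graph $H$ with no isolated vertex, set of leaves $L_H$, and $\alpha:L_H\to\mathbb{N}=\{1,2,\dots\}$, $S_2(H)$ has vertex set $V^o_{S_2(H)}\cup V^n_{S_2(H)}$ where $V^o_{S_2(H)}=(V_H\setminus L_H)\cup\{(v,i): v\in L_H, 1\le i\le \alpha(v)\}$ and $V^n_{S_2(H)}$ consists of two new vertices for each edge $e$ of $H$ ($u_e,v_e$ if $e$ joins $u\ne v$; $v_e^1,v_e^2$ if $e$ is a loop at $v$). Its edges are: the edge joining the two new vertices of each $e$; for $v\in V_H\setminus L_H$, $vv_e$ for each non-loop edge $e$ at $v$ and $vv_e^1,vv_e^2$ for each loop $e$ at $v$; for $v\in L_H$ with incident edge $e$, the edges $v_e(v,i)$, $1\le i\le\alpha(v)$.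 *)

theory Defs
  imports Main
begin

section \<open>Finite multigraphs with loops\<close>

text \<open>A multigraph: a vertex set, an edge set (edges are abstract identifiers, so
parallel edges are allowed) and an incidence map sending each edge to its set of
end vertices (a singleton for a loop, a two-element set otherwise).\<close>

record ('v, 'e) mgraph =
  verts :: "'v set"
  edges :: "'e set"
  ends  :: "'e \<Rightarrow> 'v set"

definition wf_mgraph :: "('v, 'e) mgraph \<Rightarrow> bool" where
  "wf_mgraph G \<longleftrightarrow> finite (verts G) \<and> finite (edges G) \<and>
     (\<forall>e\<in>edges G. ends G e \<subseteq> verts G \<and> (card (ends G e) = 1 \<or> card (ends G e) = 2))"

definition is_loop :: "('v, 'e) mgraph \<Rightarrow> 'e \<Rightarrow> bool" where
  "is_loop G e \<longleftrightarrow> card (ends G e) = 1"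

text \<open>Degree; a loop contributes 2.\<close>
definition degree :: "('v, 'e) mgraph \<Rightarrow> 'v \<Rightarrow> nat" where
  "degree G v = card {e\<in>edges G. v \<in> ends G e \<and> card (ends G e) = 2}
               + 2 * card {e\<in>edges G. ends G e = {v}}"

definition leaves :: "('v, 'e) mgraph \<Rightarrow> 'v set" where
  "leaves G = {v\<in>verts G. degree G v = 1}"

definition no_isolated :: "('v, 'e) mgraph \<Rightarrow> bool" where
  "no_isolated G \<longleftrightarrow> (\<forall>v\<in>verts G. degree G v \<noteq> 0)"

definition adj :: "('v, 'e) mgraph \<Rightarrow> 'v \<Rightarrow> 'v \<Rightarrow> bool" where
  "adj G u v \<longleftrightarrow> (\<exists>e\<in>edges G. ends G e = {u, v})"

definition connected :: "('v, 'e) mgraph \<Rightarrow> bool" where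
  "connected G \<longleftrightarrow> verts G \<noteq> {} \<and>
     (\<forall>u\<in>verts G. \<forall>v\<in>verts G. (u, v) \<in> {(x, y). adj G x y}\<^sup>*)"

definition iso :: "('v, 'e) mgraph \<Rightarrow> ('w, 'f) mgraph \<Rightarrow> bool" where
  "iso G1 G2 \<longleftrightarrow> (\<exists>f g. bij_betw f (verts G1) (verts G2) \<and> bij_betw g (edges G1) (edges G2) \<and>
      (\<forall>e\<in>edges G1. ends G2 (g e) = f ` ends G1 e))"

text \<open>The cycle of length n (n \<ge> 3).\<close>
definition cycle_graph :: "nat \<Rightarrow> (nat, nat) mgraph" where
  "cycle_graph n = \<lparr>verts = {0..<n}, edges = {0..<n}, ends = (\<lambda>i. {i, Suc i mod n})\<rparr>"

definition is_cycle_of_length :: "('v, 'e) mgraph \<Rightarrow> nat \<Rightarrow> bool" where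
  "is_cycle_of_length G n \<longleftrightarrow> n \<ge> 3 \<and> iso G (cycle_graph n)"

section \<open>Domination notions\<close>

definition dominating :: "('v, 'e) mgraph \<Rightarrow> 'v set \<Rightarrow> bool" where
  "dominating G D \<longleftrightarrow> D \<subseteq> verts G \<and> (\<forall>v\<in>verts G - D. \<exists>u\<in>D. adj G u v)"

text \<open>A perfect matching of the subgraph induced by P: a set of non-loop edges with
both ends in P such that each vertex of P lies on exactly one of them.\<close>
definition has_perfect_matching_induced :: "('v, 'e) mgraph \<Rightarrow> 'v set \<Rightarrow> bool" where
  "has_perfect_matching_induced G P \<longleftrightarrow>
     (\<exists>M\<subseteq>edges G. (\<forall>e\<in>M. card (ends G e) = 2 \<and> ends G e \<subseteq> P) \<and>
                   (\<forall>v\<in>P. \<exists>!e. e \<in> M \<and> v \<in> ends G e))"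

definition paired_dominating :: "('v, 'e) mgraph \<Rightarrow> 'v set \<Rightarrow> bool" where
  "paired_dominating G P \<longleftrightarrow> dominating G P \<and> has_perfect_matching_induced G P"

definition DP_pair :: "('v, 'e) mgraph \<Rightarrow> 'v set \<Rightarrow> 'v set \<Rightarrow> bool" where
  "DP_pair G D P \<longleftrightarrow> D \<inter> P = {} \<and> verts G = D \<union> P \<and> dominating G D \<and> paired_dominating G P"

definition DPDP_graph :: "('v, 'e) mgraph \<Rightarrow> bool" where
  "DPDP_graph G \<longleftrightarrow> (\<exists>D P. DP_pair G D P)"

text \<open>Proper spanning subgraphs: same vertex set, a proper subset of the edges.\<close>
definition minimal_DPDP_graph :: "('v, 'e) mgraph \<Rightarrow> bool" where
  "minimal_DPDP_graph G \<longleftrightarrow> DPDP_graph G \<and>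
     (\<forall>E'. E' \<subset> edges G \<longrightarrow> \<not> DPDP_graph (G\<lparr>edges := E'\<rparr>))"

section \<open>The 2-subdivision graph\<close>

datatype ('a, 'b) s2v =
    Old 'a            \<comment> \<open>non-leaf vertex v of H\<close>
  | Cp 'a nat         \<comment> \<open>copy (v,i) of a leaf v\<close>
  | Nw 'b 'a          \<comment> \<open>new vertex v_e for a non-loop edge e at v\<close>
  | Lp 'b nat         \<comment> \<open>new vertex v_e^i (i = 1,2) for a loop e\<close>

datatype ('a, 'b) s2e =
    Mid 'b            \<comment> \<open>edge joining the two new vertices of e\<close>
  | Att 'b 'a         \<comment> \<open>edge v v_e, v non-leaf, e non-loop\<close>
  | LAtt 'b nat       \<comment> \<open>edge v v_e^i, e a loop at v\<close>
  | LfAtt 'a nat      \<comment> \<open>edge v_e (v,i), v a leaf with incident edge e\<close>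

definition leaf_edge :: "('a, 'b) mgraph \<Rightarrow> 'a \<Rightarrow> 'b" where
  "leaf_edge H v = (SOME e. e \<in> edges H \<and> v \<in> ends H e)"

definition S2_old :: "('a, 'b) mgraph \<Rightarrow> ('a \<Rightarrow> nat) \<Rightarrow> ('a, 'b) s2v set" where
  "S2_old H \<alpha> = Old ` (verts H - leaves H) \<union>
                 {Cp v i | v i. v \<in> leaves H \<and> 1 \<le> i \<and> i \<le> \<alpha> v}"

definition S2_new :: "('a, 'b) mgraph \<Rightarrow> ('a, 'b) s2v set" where
  "S2_new H = {Nw e u | e u. e \<in> edges H \<and> card (ends H e) = 2 \<and> u \<in> ends H e} \<union>
              {Lp e i | e i. e \<in> edges H \<and> card (ends H e) = 1 \<and> i \<in> {1, 2}}"

fun S2_ends :: "('a, 'b) mgraph \<Rightarrow> ('a, 'b) s2e \<Rightarrow> ('a, 'b) s2v set" where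
  "S2_ends H (Mid e) = (if card (ends H e) = 2 then Nw e ` ends H e else {Lp e 1, Lp e 2})"
| "S2_ends H (Att e v) = {Old v, Nw e v}"
| "S2_ends H (LAtt e i) = {Old (the_elem (ends H e)), Lp e i}"
| "S2_ends H (LfAtt v i) = {Nw (leaf_edge H v) v, Cp v i}"

definition S2 :: "('a, 'b) mgraph \<Rightarrow> ('a \<Rightarrow> nat) \<Rightarrow> (('a, 'b) s2v, ('a, 'b) s2e) mgraph" where
  "S2 H \<alpha> = \<lparr>verts = S2_old H \<alpha> \<union> S2_new H,
     edges = Mid ` edges H
           \<union> {Att e v | e v. e \<in> edges H \<and> card (ends H e) = 2 \<and> v \<in> ends H e \<and> v \<notin> leaves H}
           \<union> {LAtt e i | e i. e \<in> edges H \<and> card (ends H e) = 1 \<and> i \<in> {1, 2}}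
           \<union> {LfAtt v i | v i. v \<in> leaves H \<and> 1 \<le> i \<and> i \<le> \<alpha> v},
     ends = S2_ends H\<rparr>"

end

theory Submission
  imports Defs
begin

text \<open>
Let \<open>(D, P)\<close> be a DP-pair of a minimal DPDP-graph \<open>G\<close> and \<open>M\<close> a perfect matching of \<open>P\<close>. By
minimality every edge lies in \<open>M\<close> or joins \<open>D\<close> to \<open>P\<close>, and the latter edges form disjoint stars.
Contracting these stars, and keeping \<open>M\<close> as edge set, gives \<open>H\<close> with \<open>G = S\<^sub>2(H)\<close>.

If \<open>(D', P')\<close> is a second DP-pair, a vertex that changes sides is in neither pair a leaf or the
neighbour of a leaf, hence has degree two. The structure above then propagates: the neighbours of a
vertex of \<open>D \<inter> P'\<close>, \<open>P \<inter> D'\<close> or \<open>P \<inter> P'\<close> lie one in each of the other two sets. So \<open>G\<close> is a cycle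
of length \<open>3k\<close>, and for \<open>k \<ge> 4\<close> three of its edges can be deleted. Conversely, every edge of
\<open>S\<^sub>2(H)\<close> is needed for the DP-pair of old and new vertices, and a proper spanning subgraph of a
cycle of length 3, 6 or 9 is not a DPDP-graph.
\<close>

subsection \<open>Isomorphisms\<close>

text \<open>The stars arise because the middle edge of a path \<open>d' p d p'\<close> can be
  deleted: \<open>d\<close> keeps the neighbour \<open>p'\<close> and \<open>p\<close> keeps
  \<open>d'\<close>. A star whose centre in \<open>D\<close> has several neighbours becomes a
  non-leaf of \<open>H\<close>; every other star becomes a leaf of \<open>H\<close> whose copies are
  its vertices in \<open>D\<close>. The exceptions stop at 9 for the following reason. On a path,
  vertices in \<open>P\<close> come in runs of exactly two and the ends lie in \<open>D\<close>;
  cutting between adjacent vertices of \<open>D\<close> leaves blocks \<open>DPPD...PPD\<close> of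
  order \<open>3m + 1\<close> with \<open>m \<ge> 1\<close>. If a cycle of length \<open>3k\<close>
  loses an edge and is still a DPDP-graph, it splits into such blocks, whose number is then
  divisible by 3. So there are at least three blocks of at least four vertices, and 12 is the first
  length where this is possible, with blocks of order 4, 4 and \<open>n - 8\<close>. The structure
  is read off inside \<open>G\<close>, while \<open>S2 H \<alpha>\<close> has other types of
  vertices and edges, so every notion is transported along explicit isomorphisms. In particular the
  pair of old and new vertices is obtained as the image of \<open>(D, P)\<close>.\<close>

text \<open>Names the two maps, so that inverses and images can be formed. The clause
  \<open>ends G1 e \<subseteq> verts G1\<close> makes the relation symmetric, since \<open>f\<close>
  is arbitrary outside \<open>verts G1\<close>.\<close>

definition iso_map :: "('v \<Rightarrow> 'w) \<Rightarrow> ('e \<Rightarrow> 'f) \<Rightarrow> ('v, 'e) mgraph \<Rightarrow> ('w, 'f) mgraph \<Rightarrow> bool" where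
  "iso_map f g G1 G2 \<longleftrightarrow> bij_betw f (verts G1) (verts G2) \<and> bij_betw g (edges G1) (edges G2) \<and>
     (\<forall>e\<in>edges G1. ends G1 e \<subseteq> verts G1 \<and> ends G2 (g e) = f ` ends G1 e)"

lemma iso_iff_iso_map:
  assumes "\<forall>e\<in>edges G1. ends G1 e \<subseteq> verts G1"
  shows "iso G1 G2 \<longleftrightarrow> (\<exists>f g. iso_map f g G1 G2)"
  using assms unfolding iso_def iso_map_def by auto

lemma wf_mgraph_ends: "wf_mgraph G \<Longrightarrow> \<forall>e\<in>edges G. ends G e \<subseteq> verts G"
  by (simp add: wf_mgraph_def)

lemma iso_map_sym:
  assumes "iso_map f g G1 G2"
  shows "iso_map (inv_into (verts G1) f) (inv_into (edges G1) g) G2 G1"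
proof -
  have f: "bij_betw f (verts G1) (verts G2)" and g: "bij_betw g (edges G1) (edges G2)"
    and e: "\<And>e. e \<in> edges G1 \<Longrightarrow> ends G1 e \<subseteq> verts G1 \<and> ends G2 (g e) = f ` ends G1 e"
    using assms by (auto simp: iso_map_def)
  have "ends G2 x \<subseteq> verts G2 \<and> ends G1 (inv_into (edges G1) g x) = inv_into (verts G1) f ` ends G2 x"
    if "x \<in> edges G2" for x
  proof -
    obtain y where y: "y \<in> edges G1" "x = g y"
      using g \<open>x \<in> edges G2\<close> by (auto simp: bij_betw_def)
    then have "inv_into (edges G1) g x = y"
      using g by (simp add: bij_betw_def)
    moreover have "inv_into (verts G1) f ` f ` ends G1 y = ends G1 y"
      using e[OF y(1)] f by (intro inv_into_image_cancel) (auto simp: bij_betw_def)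
    ultimately show ?thesis
      using e[OF y(1)] f y by (auto simp: bij_betw_def)
  qed
  then show ?thesis
    using f g by (simp add: iso_map_def bij_betw_inv_into)
qed

lemma adj_commute: "adj G u v \<longleftrightarrow> adj G v u"
  by (simp add: adj_def insert_commute)

lemma iso_map_adj:
  assumes "iso_map f g G1 G2" and "adj G1 u v"
  shows "adj G2 (f u) (f v)"
proof -
  obtain e where "e \<in> edges G1" "ends G1 e = {u, v}"
    using assms(2) by (auto simp: adj_def)
  then have "g e \<in> edges G2" "ends G2 (g e) = {f u, f v}"
    using assms(1) by (auto simp: iso_map_def bij_betw_def)
  then show ?thesis
    by (auto simp: adj_def)
qed

lemma iso_map_dominating:
  assumes "iso_map f g G1 G2" and "dominating G1 D"
  shows "dominating G2 (f ` D)"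
  unfolding dominating_def
proof (intro conjI ballI)
  have f: "f ` verts G1 = verts G2"
    using assms(1) by (auto simp: iso_map_def bij_betw_def)
  then show "f ` D \<subseteq> verts G2"
    using assms(2) by (auto simp: dominating_def)
  fix v assume "v \<in> verts G2 - f ` D"
  then obtain u where "u \<in> verts G1 - D" "v = f u"
    using f by auto
  then obtain d where "d \<in> D" "adj G1 d u"
    using assms(2) by (auto simp: dominating_def)
  then show "\<exists>u\<in>f ` D. adj G2 u v"
    using iso_map_adj[OF assms(1)] \<open>v = f u\<close> by blast
qed

lemma iso_map_matching:
  assumes "iso_map f g G1 G2" and "has_perfect_matching_induced G1 P" and "P \<subseteq> verts G1"
  shows "has_perfect_matching_induced G2 (f ` P)"
proof -
  have f: "inj_on f (verts G1)" and g: "inj_on g (edges G1)" "g ` edges G1 = edges G2"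
    and e: "\<And>e. e \<in> edges G1 \<Longrightarrow> ends G1 e \<subseteq> verts G1 \<and> ends G2 (g e) = f ` ends G1 e"
    using assms(1) by (auto simp: iso_map_def bij_betw_def)
  obtain M where M: "M \<subseteq> edges G1" "\<And>e. e \<in> M \<Longrightarrow> card (ends G1 e) = 2 \<and> ends G1 e \<subseteq> P"
    "\<And>v. v \<in> P \<Longrightarrow> \<exists>!e. e \<in> M \<and> v \<in> ends G1 e"
    using assms(2) unfolding has_perfect_matching_induced_def by metis
  have mem: "f v \<in> ends G2 (g x) \<longleftrightarrow> v \<in> ends G1 x" if "x \<in> M" "v \<in> P" for x v
    using e[of x] that f M(1) assms(3) by (auto simp: subset_eq inj_on_eq_iff)
  have card: "card (ends G2 (g x)) = 2 \<and> ends G2 (g x) \<subseteq> f ` P" if "x \<in> M" for x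
  proof -
    have "card (f ` ends G1 x) = card (ends G1 x)"
      using e[of x] M(1) that f by (intro card_image) (auto intro: inj_on_subset)
    moreover have "ends G2 (g x) = f ` ends G1 x"
      using e M(1) that by blast
    ultimately show ?thesis
      using M(2)[OF that] by auto
  qed
  have "\<forall>v\<in>f ` P. \<exists>!y. y \<in> g ` M \<and> v \<in> ends G2 y"
  proof (intro ballI, elim imageE, hypsubst)
    fix v assume v: "v \<in> P"
    obtain x where x: "x \<in> M" "v \<in> ends G1 x" "\<And>y. y \<in> M \<Longrightarrow> v \<in> ends G1 y \<Longrightarrow> y = x"
      using M(3)[OF v] by blast
    show "\<exists>!y. y \<in> g ` M \<and> f v \<in> ends G2 y"
    proof (rule ex1I[of _ "g x"])
      show "g x \<in> g ` M \<and> f v \<in> ends G2 (g x)"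
        using x mem v by blast
      show "y = g x" if "y \<in> g ` M \<and> f v \<in> ends G2 y" for y
        using that x(3) mem v by blast
    qed
  qed
  moreover have "g ` M \<subseteq> edges G2"
    using M(1) g(2) by blast
  moreover have "\<forall>y\<in>g ` M. card (ends G2 y) = 2 \<and> ends G2 y \<subseteq> f ` P"
    using card by simp
  ultimately show ?thesis
    unfolding has_perfect_matching_induced_def by (intro exI conjI)
qed

lemma iso_map_DP_pair:
  assumes "iso_map f g G1 G2" and "DP_pair G1 D P"
  shows "DP_pair G2 (f ` D) (f ` P)"
proof -
  have f: "inj_on f (verts G1)" "f ` verts G1 = verts G2"
    using assms(1) by (auto simp: iso_map_def bij_betw_def)
  have DP: "D \<inter> P = {}" "verts G1 = D \<union> P" "dominating G1 D" "dominating G1 P"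
    "has_perfect_matching_induced G1 P"
    using assms(2) by (auto simp: DP_pair_def paired_dominating_def)
  then have "f ` D \<inter> f ` P = {}"
    using f(1) by (auto simp: inj_on_def)
  then show ?thesis
    using DP f(2)[symmetric] iso_map_dominating[OF assms(1)] iso_map_matching[OF assms(1), of P]
    by (simp add: DP_pair_def paired_dominating_def image_Un)
qed

lemma iso_map_restrict:
  assumes "iso_map f g G1 G2" and "E \<subseteq> edges G1"
  shows "iso_map f g (G1\<lparr>edges := E\<rparr>) (G2\<lparr>edges := g ` E\<rparr>)"
  using assms by (auto simp: iso_map_def bij_betw_def intro: inj_on_subset)

text \<open>A spanning DPDP-subgraph of \<open>G2\<close> is pulled back along the inverse maps;
  injectivity of the edge map keeps the edge set proper.\<close>

lemma iso_map_minimal: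
  assumes "iso_map f g G1 G2" and "minimal_DPDP_graph G1"
  shows "minimal_DPDP_graph G2"
  unfolding minimal_DPDP_graph_def
proof (intro conjI allI impI notI)
  show "DPDP_graph G2"
    using assms iso_map_DP_pair unfolding minimal_DPDP_graph_def DPDP_graph_def by metis
  fix E assume E: "E \<subset> edges G2" "DPDP_graph (G2\<lparr>edges := E\<rparr>)"
  let ?g = "inv_into (edges G1) g"
  have sym: "iso_map (inv_into (verts G1) f) ?g G2 G1"
    by (rule iso_map_sym[OF assms(1)])
  then have g: "inj_on ?g (edges G2)" "?g ` edges G2 = edges G1"
    by (auto simp: iso_map_def bij_betw_def)
  have "DPDP_graph (G1\<lparr>edges := ?g ` E\<rparr>)"
    using iso_map_DP_pair[OF iso_map_restrict[OF sym, of E]] E unfolding DPDP_graph_def by blast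
  moreover have "?g ` E \<subset> edges G1"
    using g E(1) inj_on_image_eq_iff[OF g(1), of E "edges G2"] by auto
  ultimately show False
    using assms(2) by (auto simp: minimal_DPDP_graph_def)
qed

lemma iso_map_wf:
  assumes "iso_map f g G1 G2" and "wf_mgraph G1"
  shows "wf_mgraph G2"
proof -
  have f: "inj_on f (verts G1)" "f ` verts G1 = verts G2" and g: "g ` edges G1 = edges G2"
    and e: "\<And>e. e \<in> edges G1 \<Longrightarrow> ends G1 e \<subseteq> verts G1 \<and> ends G2 (g e) = f ` ends G1 e"
    using assms(1) by (auto simp: iso_map_def bij_betw_def)
  have fin: "finite (verts G2)" "finite (edges G2)"
    using assms(2) f(2) g by (auto simp: wf_mgraph_def simp flip: f(2) g)
  moreover have "ends G2 (g x) \<subseteq> verts G2 \<and> card (ends G2 (g x)) = card (ends G1 x)" if "x \<in> edges G1" for x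
    using e[OF that] f by (auto intro!: card_image intro: inj_on_subset)
  ultimately show ?thesis
    using assms(2) unfolding wf_mgraph_def g[symmetric] by auto
qed

lemma iso_map_connected:
  assumes "iso_map f g G1 G2" and "connected G1"
  shows "connected G2"
proof -
  have f: "f ` verts G1 = verts G2"
    using assms(1) by (auto simp: iso_map_def bij_betw_def)
  have "(f u, f v) \<in> {(x, y). adj G2 x y}\<^sup>*" if "(u, v) \<in> {(x, y). adj G1 x y}\<^sup>*" for u v
    using that
  proof (induction rule: rtrancl_induct)
    case (step y z)
    then show ?case
      using iso_map_adj[OF assms(1)] by (auto intro: rtrancl_into_rtrancl)
  qed simp
  then show ?thesis
    using assms(2) unfolding connected_def f[symmetric] by auto
qed

text \<open>In the absence of parallel edges the edge map is determined by the vertex map.\<close>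
lemma iso_map_simple:
  assumes "bij_betw f (verts G1) (verts G2)"
    and "inj_on (ends G1) (edges G1)" "inj_on (ends G2) (edges G2)"
    and "\<forall>e\<in>edges G1. ends G1 e \<subseteq> verts G1"
    and "(\<lambda>e. f ` ends G1 e) ` edges G1 = ends G2 ` edges G2"
  shows "\<exists>g. iso_map f g G1 G2"
proof -
  have inj1: "inj_on (\<lambda>e. f ` ends G1 e) (edges G1)"
  proof (rule inj_onI)
    fix x y assume *: "x \<in> edges G1" "y \<in> edges G1" "f ` ends G1 x = f ` ends G1 y"
    have "inj_on f (verts G1)"
      using assms(1) by (simp add: bij_betw_def)
    then have "ends G1 x = ends G1 y"
      using * assms(4) by (metis inj_on_image_eq_iff)
    then show "x = y"
      using * assms(2) by (auto dest: inj_onD)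
  qed
  let ?g = "\<lambda>e. inv_into (edges G2) (ends G2) (f ` ends G1 e)"
  have "bij_betw (inv_into (edges G2) (ends G2)) (ends G2 ` edges G2) (edges G2)"
    using assms(3) by (simp add: bij_betw_inv_into inj_on_imp_bij_betw)
  moreover have "bij_betw (\<lambda>e. f ` ends G1 e) (edges G1) (ends G2 ` edges G2)"
    using inj1 assms(5) by (simp add: bij_betw_def)
  ultimately have "bij_betw ?g (edges G1) (edges G2)"
    using bij_betw_trans[unfolded comp_def] by blast
  moreover have "ends G2 (?g e) = f ` ends G1 e" if "e \<in> edges G1" for e
    using that assms(5) by (intro f_inv_into_f) blast
  ultimately show ?thesis
    using assms(1,4) unfolding iso_map_def by blast
qed

subsection \<open>DP-pairs of minimal DPDP-graphs\<close>

lemma card_2_other: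
  assumes "card A = 2" "p \<in> A"
  obtains q where "A = {p, q}" "q \<noteq> p"
proof -
  obtain x y where xy: "A = {x, y}" "x \<noteq> y"
    using assms(1) by (auto simp: card_2_iff)
  show ?thesis
  proof (cases "p = x")
    case True
    then show ?thesis
      using that[of y] xy by simp
  next
    case False
    then have "p = y"
      using assms(2) xy by simp
    then show ?thesis
      using that[of x] xy by (simp add: insert_commute)
  qed
qed

text \<open>The matching is fixed along with the pair, because an edge inside \<open>P\<close> can
  only be necessary by belonging to it.\<close>

locale minimal_DP =
  fixes G :: "('v, 'e) mgraph" and D P :: "'v set" and M :: "'e set"
  assumes wf: "wf_mgraph G" and minimal: "minimal_DPDP_graph G"
    and DP: "DP_pair G D P"
    and M_edges: "M \<subseteq> edges G"
    and M_ends: "e \<in> M \<Longrightarrow> card (ends G e) = 2 \<and> ends G e \<subseteq> P"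
    and M_unique: "v \<in> P \<Longrightarrow> \<exists>!e. e \<in> M \<and> v \<in> ends G e"
begin

lemma disjoint: "D \<inter> P = {}" and verts_eq: "verts G = D \<union> P"
  using DP by (auto simp: DP_pair_def)

lemma D_nbr: "d \<in> D \<Longrightarrow> \<exists>p\<in>P. adj G d p"
  using DP by (subst adj_commute) (auto simp: DP_pair_def paired_dominating_def dominating_def)

lemma P_nbr: "p \<in> P \<Longrightarrow> \<exists>d\<in>D. adj G p d"
  using DP by (subst adj_commute) (auto simp: DP_pair_def dominating_def)

text \<open>Minimality in the form used throughout: an edge set that contains \<open>M\<close> and
  serves every vertex across the partition still carries the pair \<open>(D, P)\<close>, so nothing
  was deleted.\<close>

lemma spanning_eq:
  assumes "E \<subseteq> edges G" and "M \<subseteq> E"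
    and D: "\<And>d. d \<in> D \<Longrightarrow> \<exists>e\<in>E. \<exists>p\<in>P. ends G e = {d, p}"
    and P: "\<And>p. p \<in> P \<Longrightarrow> \<exists>e\<in>E. \<exists>d\<in>D. ends G e = {d, p}"
  shows "E = edges G"
proof -
  let ?G = "G\<lparr>edges := E\<rparr>"
  have "dominating ?G D"
    using P verts_eq by (fastforce simp: dominating_def adj_def)
  moreover have "dominating ?G P"
    using D verts_eq by (fastforce simp: dominating_def adj_def insert_commute)
  moreover have "has_perfect_matching_induced ?G P"
    unfolding has_perfect_matching_induced_def
    using M_ends M_unique assms(2) by (intro exI[of _ M]) auto
  ultimately have "DP_pair ?G D P"
    using disjoint verts_eq by (simp add: DP_pair_def paired_dominating_def)
  then show ?thesis
    using minimal assms(1) by (auto simp: minimal_DPDP_graph_def DPDP_graph_def)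
qed

text \<open>The matching together with all edges between \<open>D\<close> and \<open>P\<close>
  suffices for \<open>spanning_eq\<close>. This also excludes loops.\<close>

lemma edge_cases:
  assumes "e \<in> edges G"
  obtains "e \<in> M" | d p where "d \<in> D" "p \<in> P" "ends G e = {d, p}"
proof -
  let ?E = "M \<union> {e \<in> edges G. \<exists>d\<in>D. \<exists>p\<in>P. ends G e = {d, p}}"
  have "?E = edges G"
  proof (rule spanning_eq)
    show "\<exists>e\<in>?E. \<exists>p\<in>P. ends G e = {d, p}" if "d \<in> D" for d
      using D_nbr[OF that] that by (auto simp: adj_def)
    show "\<exists>e\<in>?E. \<exists>d\<in>D. ends G e = {d, p}" if "p \<in> P" for p
      using P_nbr[OF that] that by (auto simp: adj_def insert_commute)
  qed (use M_edges in auto)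
  then show ?thesis
    using assms that by blast
qed

lemma removable:
  assumes "x \<in> edges G" and "x \<notin> M"
    and D: "\<And>d. d \<in> D \<Longrightarrow> \<exists>e\<in>edges G - {x}. \<exists>p\<in>P. ends G e = {d, p}"
    and P: "\<And>p. p \<in> P \<Longrightarrow> \<exists>e\<in>edges G - {x}. \<exists>d\<in>D. ends G e = {d, p}"
  shows False
proof -
  have "edges G - {x} = edges G"
    using assms M_edges by (intro spanning_eq) auto
  then show False
    using assms(1) by blast
qed

text \<open>Outside \<open>M\<close>, an edge with a parallel copy can be deleted because the copy
  takes over its domination duties. Applied to both copies, this puts both into \<open>M\<close>,
  which contradicts the uniqueness of matching edges in \<open>inj_ends\<close>.\<close>

lemma no_parallel_aux:
  assumes "x \<in> edges G" "y \<in> edges G" "ends G x = ends G y" "x \<noteq> y"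
  shows "x \<in> M"
proof (rule ccontr)
  assume "x \<notin> M"
  have *: "\<exists>e'\<in>edges G - {x}. ends G e' = ends G e" if "e \<in> edges G" for e
    using assms that by (cases "e = x") auto
  show False
  proof (rule removable[OF assms(1) \<open>x \<notin> M\<close>])
    fix d assume "d \<in> D"
    then obtain e p where "e \<in> edges G" "p \<in> P" "ends G e = {d, p}"
      using D_nbr unfolding adj_def by blast
    then show "\<exists>e\<in>edges G - {x}. \<exists>p\<in>P. ends G e = {d, p}"
      using *[of e] by auto
  next
    fix p assume "p \<in> P"
    then obtain e d where "e \<in> edges G" "d \<in> D" "ends G e = {d, p}"
      using P_nbr unfolding adj_def by (metis insert_commute)
    then show "\<exists>e\<in>edges G - {x}. \<exists>d\<in>D. ends G e = {d, p}"
      using *[of e] by auto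
  qed
qed

lemma inj_ends: "inj_on (ends G) (edges G)"
proof (rule inj_onI, rule ccontr)
  fix x y assume *: "x \<in> edges G" "y \<in> edges G" "ends G x = ends G y" "x \<noteq> y"
  then have "x \<in> M" "y \<in> M"
    using no_parallel_aux[of x y] no_parallel_aux[of y x] by auto
  moreover from \<open>x \<in> M\<close> obtain v where "v \<in> ends G x" "v \<in> P"
    using M_ends[of x] by (metis card_2_iff' subsetD)
  ultimately show False
    using M_unique[of v] * by auto
qed

lemma adj_D_P: "d \<in> D \<Longrightarrow> adj G d p \<Longrightarrow> p \<in> P"
proof -
  assume d: "d \<in> D" "adj G d p"
  then obtain e where e: "e \<in> edges G" "ends G e = {d, p}"
    by (auto simp: adj_def)
  from e(1) show "p \<in> P"
  proof (cases rule: edge_cases)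
    case 1
    then show ?thesis
      using M_ends[of e] e d disjoint by auto
  next
    case (2 d' p')
    then show ?thesis
      using e d disjoint by (auto simp: doubleton_eq_iff)
  qed
qed

text \<open>If both alternatives fail, the edge between \<open>d\<close> and \<open>p\<close> is the
  middle of a path \<open>d' p d p'\<close> and is removable.\<close>

lemma star:
  assumes "d \<in> D" "p \<in> P" "adj G d p"
  shows "(\<forall>d'\<in>D. adj G d' p \<longrightarrow> d' = d) \<or> (\<forall>p'. adj G d p' \<longrightarrow> p' = p)"
proof (rule ccontr)
  assume "\<not> ?thesis"
  then obtain d' p' where d': "d' \<in> D" "adj G d' p" "d' \<noteq> d" and p': "adj G d p'" "p' \<noteq> p"
    by blast
  have "p' \<in> P"
    using adj_D_P assms(1) p'(1) by blast
  obtain x where x: "x \<in> edges G" "ends G x = {d, p}"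
    using assms(3) by (auto simp: adj_def)
  have xM: "x \<notin> M"
    using M_ends[of x] x assms(1) disjoint by auto
  show False
  proof (rule removable[OF x(1) xM])
    fix u assume "u \<in> D"
    \<comment> \<open>For \<open>u = d\<close> take \<open>p'\<close>; for any other
      \<open>u\<close> every neighbour in \<open>P\<close> will do.\<close>
    then obtain q where q: "q \<in> P" "adj G u q" "(u, q) \<noteq> (d, p)"
      using D_nbr p' \<open>p' \<in> P\<close> by (metis prod.inject)
    have "{u, q} \<noteq> {d, p}"
      using q \<open>u \<in> D\<close> assms disjoint by (auto simp: doubleton_eq_iff)
    then show "\<exists>e\<in>edges G - {x}. \<exists>p\<in>P. ends G e = {u, p}"
      using q x unfolding adj_def by (metis DiffI singletonD)
  next
    fix q assume "q \<in> P"
    then obtain u where u: "u \<in> D" "adj G u q" "(u, q) \<noteq> (d, p)"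
      using P_nbr d' adj_commute by (metis prod.inject)
    have "{u, q} \<noteq> {d, p}"
      using u \<open>q \<in> P\<close> assms disjoint by (auto simp: doubleton_eq_iff)
    then show "\<exists>e\<in>edges G - {x}. \<exists>d\<in>D. ends G e = {d, q}"
      using u x unfolding adj_def by (metis DiffI singletonD)
  qed
qed

lemma mate_edge:
  assumes "p \<in> P" "q \<in> P" "e \<in> edges G" "ends G e = {p, q}"
  shows "e \<in> M"
  using assms(3)
proof (cases rule: edge_cases)
  case (2 d' p')
  then show ?thesis
    using assms disjoint by (auto simp: doubleton_eq_iff)
qed

text \<open>By \<open>mate_edge\<close>, the edges inside \<open>P\<close> are exactly those of
  \<open>M\<close>, so uniqueness of the matching edge becomes uniqueness of the neighbour.\<close>

lemma mate: "p \<in> P \<Longrightarrow> \<exists>!q. q \<in> P \<and> adj G p q"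
proof -
  assume p: "p \<in> P"
  then obtain e where e: "e \<in> M" "p \<in> ends G e" and uniq: "\<And>e'. e' \<in> M \<Longrightarrow> p \<in> ends G e' \<Longrightarrow> e' = e"
    using M_unique by blast
  have "card (ends G e) = 2"
    using M_ends e by auto
  then obtain q where q: "ends G e = {p, q}" "q \<noteq> p"
    using e(2) by (rule card_2_other)
  show ?thesis
  proof (rule ex1I[of _ q])
    show "q \<in> P \<and> adj G p q"
      using q M_ends[of e] e M_edges by (auto simp: adj_def)
    fix q' assume "q' \<in> P \<and> adj G p q'"
    then obtain e' where e': "e' \<in> edges G" "ends G e' = {p, q'}" "q' \<in> P"
      by (auto simp: adj_def)
    then have "e' = e"
      using mate_edge[OF p] uniq[of e'] by auto
    then show "q' = q"
      using e' q by (auto simp: doubleton_eq_iff)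
  qed
qed

end

lemma minimal_DP_ex:
  assumes "wf_mgraph G" "minimal_DPDP_graph G" "DP_pair G D P"
  obtains M where "minimal_DP G D P M"
proof -
  obtain M where "M\<subseteq>edges G" "\<forall>e\<in>M. card (ends G e) = 2 \<and> ends G e \<subseteq> P"
    "\<forall>v\<in>P. \<exists>!e. e \<in> M \<and> v \<in> ends G e"
    using assms(3) unfolding DP_pair_def paired_dominating_def has_perfect_matching_induced_def by metis
  then show ?thesis
    using assms that[of M] by (simp add: minimal_DP_def)
qed

subsection \<open>Two distinct DP-pairs force a cycle\<close>

text \<open>Keeps only those consequences of minimality that speak of adjacency. Each is assumed for
  both pairs, so that \<open>swap\<close> gives every result a mirror image.\<close>

locale two_DP_pairs =
  fixes V :: "'v set" and R :: "'v \<Rightarrow> 'v \<Rightarrow> bool" and D P D' P' :: "'v set"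
  assumes sym: "R x y \<Longrightarrow> R y x" and in_V: "R x y \<Longrightarrow> y \<in> V"
    and V: "V = D \<union> P" "V = D' \<union> P'" "D \<inter> P = {}" "D' \<inter> P' = {}"
    and D_P: "d \<in> D \<Longrightarrow> R d p \<Longrightarrow> p \<in> P" "d \<in> D' \<Longrightarrow> R d p \<Longrightarrow> p \<in> P'"
    and P_nbr: "p \<in> P \<Longrightarrow> \<exists>d\<in>D. R p d" "p \<in> P' \<Longrightarrow> \<exists>d\<in>D'. R p d"
    and mate: "p \<in> P \<Longrightarrow> \<exists>!q. q \<in> P \<and> R p q" "p \<in> P' \<Longrightarrow> \<exists>!q. q \<in> P' \<and> R p q"
    and star: "d \<in> D \<Longrightarrow> p \<in> P \<Longrightarrow> R d p \<Longrightarrow>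
                 (\<forall>e\<in>D. R e p \<longrightarrow> e = d) \<or> (\<forall>q. R d q \<longrightarrow> q = p)"
              "d \<in> D' \<Longrightarrow> p \<in> P' \<Longrightarrow> R d p \<Longrightarrow>
                 (\<forall>e\<in>D'. R e p \<longrightarrow> e = d) \<or> (\<forall>q. R d q \<longrightarrow> q = p)"
begin

lemma swap: "two_DP_pairs V R D' P' D P"
  by unfold_locales (fact sym in_V V D_P P_nbr mate star)+

text \<open>A neighbour \<open>y\<close> of \<open>v\<close> in \<open>D'\<close> lies in
  \<open>P\<close>, hence has a further neighbour and is the centre of its star with respect to
  \<open>(D', P')\<close>. So \<open>v\<close> has no other neighbour in \<open>D'\<close>, and in
  \<open>P'\<close> it has only its mate. Both lie in \<open>P\<close> because no two vertices of
  \<open>D\<close> are adjacent.\<close>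

lemma D_P'_nbrs:
  assumes v: "v \<in> D" "v \<in> P'"
  shows "\<exists>x\<in>P \<inter> P'. \<exists>y\<in>P \<inter> D'. \<forall>z. R v z \<longleftrightarrow> z = x \<or> z = y"
proof -
  obtain x where x: "x \<in> P'" "R v x" "\<And>z. z \<in> P' \<Longrightarrow> R v z \<Longrightarrow> z = x"
    using mate(2) v by blast
  obtain y where y: "y \<in> D'" "R v y"
    using P_nbr(2) v by blast
  have P: "x \<in> P" "y \<in> P"
    using D_P(1) v x y by blast+
  have "\<exists>d\<in>D. R y d" "\<exists>q\<in>P. R y q"
    using P_nbr(1) mate(1) P(2) by blast+
  \<comment> \<open>The mate of \<open>y\<close> in \<open>P\<close> differs from \<open>v\<close>,
    which is in \<open>D\<close>.\<close>
  then have "\<not> (\<forall>z. R y z \<longrightarrow> z = v)"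
    using v V by blast
  then have "\<forall>e\<in>D'. R e v \<longrightarrow> e = y"
    using star(2)[of y v] v y sym by blast
  then have "R v z \<longleftrightarrow> z = x \<or> z = y" for z
    using x y in_V[of v z] V sym by blast
  then show ?thesis
    using x(1) y(1) P by blast
qed

lemma P_D'_nbrs:
  assumes "v \<in> P" "v \<in> D'"
  shows "\<exists>x\<in>P \<inter> P'. \<exists>y\<in>D \<inter> P'. \<forall>z. R v z \<longleftrightarrow> z = x \<or> z = y"
  using two_DP_pairs.D_P'_nbrs[OF swap, of v] assms by blast

text \<open>The vertex \<open>v\<close> plays two roles for \<open>x\<close>. It is the mate of
  \<open>x\<close> in \<open>P'\<close>, so all other neighbours are in \<open>D'\<close>. Having
  two neighbours, it is also the centre of its star for \<open>(D, P)\<close>, so it is the only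
  neighbour of \<open>x\<close> in \<open>D\<close>. What remains is the mate \<open>z\<close> of
  \<open>x\<close> in \<open>P\<close>.\<close>

lemma P_P'_nbrs_aux:
  assumes x: "x \<in> P" "x \<in> P'" and v: "v \<in> D" "v \<in> P'" "R x v"
  shows "\<exists>z\<in>P \<inter> D'. \<forall>u. R x u \<longleftrightarrow> u = v \<or> u = z"
proof -
  obtain z where z: "z \<in> P" "R x z" "\<And>u. u \<in> P \<Longrightarrow> R x u \<Longrightarrow> u = z"
    using mate(1) x by blast
  have v_mate: "u = v" if "u \<in> P'" "R x u" for u
    using mate(2) x v that by blast
  have "\<not> (\<forall>q. R v q \<longrightarrow> q = x)"
    using D_P'_nbrs[OF v(1,2)] x V by blast
  then have v_D: "\<forall>e\<in>D. R e x \<longrightarrow> e = v"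
    using star(1)[of v x] v x sym by blast
  have "z \<in> D'"
    using v_mate[of z] z v V in_V by blast
  moreover have "R x u \<longleftrightarrow> u = v \<or> u = z" for u
    using v_D v(3) z(2) z(3)[of u] in_V[of x u] V(1) sym[of x u] by blast
  ultimately show ?thesis
    using z(1) by (metis IntI)
qed

lemma P_P'_nbrs:
  assumes x: "x \<in> P" "x \<in> P'" and v: "v \<in> D \<inter> P' \<union> P \<inter> D'" "R x v"
  shows "\<exists>z\<in>P \<inter> D'. \<exists>w\<in>D \<inter> P'. \<forall>u. R x u \<longleftrightarrow> u = w \<or> u = z"
proof (cases "v \<in> D \<inter> P'")
  case True
  then obtain z where "z \<in> P \<inter> D'" "\<forall>u. R x u \<longleftrightarrow> u = v \<or> u = z"
    using P_P'_nbrs_aux[of x v] x v(2) by blast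
  then show ?thesis
    using True by metis
next
  case False
  then have *: "v \<in> P \<inter> D'"
    using v(1) by blast
  then obtain z where "z \<in> P' \<inter> D" "\<forall>u. R x u \<longleftrightarrow> u = v \<or> u = z"
    using two_DP_pairs.P_P'_nbrs_aux[OF swap, of x v] x v(2) by blast
  then have "z \<in> D \<inter> P'" "\<forall>u. R x u \<longleftrightarrow> u = z \<or> u = v"
    by auto
  then show ?thesis
    using * by metis
qed

end

text \<open>Around the cycle the colours are \<open>0, 1, 2, 0, 1, 2, \<dots>\<close>, and \<open>nxt\<close> walks in this direction.\<close>
locale tricoloured =
  fixes V :: "'v set" and R :: "'v \<Rightarrow> 'v \<Rightarrow> bool" and c :: "'v \<Rightarrow> nat"
  assumes fin: "finite V" and ne: "V \<noteq> {}" and sym: "R x y \<Longrightarrow> R y x" and in_V: "R x y \<Longrightarrow> y \<in> V"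
    and conn: "x \<in> V \<Longrightarrow> y \<in> V \<Longrightarrow> (x, y) \<in> {(x, y). R x y}\<^sup>*"
    and nbrs: "x \<in> V \<Longrightarrow> \<exists>y z. c y = Suc (c x) mod 3 \<and> c z = Suc (Suc (c x)) mod 3 \<and>
                                (\<forall>u. R x u \<longleftrightarrow> u = y \<or> u = z)"
    and colour: "c x < 3"
begin

definition nxt :: "'v \<Rightarrow> 'v" where
  "nxt x = (THE y. R x y \<and> c y = Suc (c x) mod 3)"

lemma Suc_mod_3: "Suc a mod 3 \<noteq> Suc (Suc a) mod 3" "Suc (Suc (Suc a) mod 3) mod 3 = a mod 3"
  using mod_less_divisor[of 3 a] by (simp_all add: mod_Suc) presburger

lemma ex1_nxt: "x \<in> V \<Longrightarrow> \<exists>!y. R x y \<and> c y = Suc (c x) mod 3"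
  using nbrs[of x] Suc_mod_3(1)[of "c x"] by metis

lemma nxt: "x \<in> V \<Longrightarrow> R x (nxt x) \<and> c (nxt x) = Suc (c x) mod 3"
  unfolding nxt_def by (rule theI') (rule ex1_nxt)

lemma nxt_eqI: "x \<in> V \<Longrightarrow> R x y \<Longrightarrow> c y = Suc (c x) mod 3 \<Longrightarrow> nxt x = y"
  using ex1_nxt[of x] nxt[of x] by blast

lemma nxt_in_V: "x \<in> V \<Longrightarrow> nxt x \<in> V"
  using nxt in_V by blast

text \<open>A neighbour whose colour is two steps ahead needs one more step to return to the colour
  of \<open>x\<close>, so \<open>x\<close> is its successor.\<close>

lemma R_iff:
  assumes "x \<in> V"
  shows "R x y \<longleftrightarrow> y = nxt x \<or> y \<in> V \<and> x = nxt y"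
proof
  assume R: "R x y"
  show "y = nxt x \<or> y \<in> V \<and> x = nxt y"
  proof (cases "c y = Suc (c x) mod 3")
    case False
    then have "c y = Suc (Suc (c x)) mod 3"
      using nbrs[OF assms] R by metis
    then have "c x = Suc (c y) mod 3"
      using colour[of x] Suc_mod_3(2) by simp
    then show ?thesis
      using nxt_eqI[of y x] in_V[OF R] sym[OF R] by simp
  qed (use nxt_eqI[OF assms R] in simp)
qed (use nxt[OF assms] nxt[of y] sym in blast)

text \<open>The colour of \<open>nxt x\<close> determines that of \<open>x\<close>, and a vertex has
  only one neighbour of each colour other than its own.\<close>

lemma inj_nxt: "inj_on nxt V"
proof (rule inj_onI)
  fix x y assume *: "x \<in> V" "y \<in> V" "nxt x = nxt y"
  have "nxt x \<in> V" "R (nxt x) x" "R (nxt x) y"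
    using * nxt[of x] nxt[of y] nxt_in_V sym by simp_all
  moreover have "Suc (c x) mod 3 = Suc (c y) mod 3"
    using * nxt[of x] nxt[of y] by simp
  then have "c x = c y"
    using colour[of x] colour[of y] by (auto simp: mod_Suc split: if_splits)
  moreover have "c x = Suc (Suc (c (nxt x))) mod 3"
    using nxt[OF *(1)] colour[of x] by (simp add: mod_Suc)
  ultimately show "x = y"
    using nbrs[of "nxt x"] Suc_mod_3(1)[of "c (nxt x)"] by metis
qed

lemma funpow_nxt: "x \<in> V \<Longrightarrow> (nxt ^^ i) x \<in> V \<and> c ((nxt ^^ i) x) = (c x + i) mod 3"
proof (induction i)
  case 0
  then show ?case
    using colour[of x] by simp
next
  case (Suc i)
  then show ?case
    using nxt nxt_in_V by (auto simp: mod_Suc_eq)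
qed

text \<open>\<open>w\<close> is the orbit of a vertex under \<open>nxt\<close> and \<open>n\<close>
  its first return time; a finite orbit of an injective map returns to its start. The orbit is
  closed under \<open>R\<close>, so connectedness makes it all of \<open>V\<close>. One round raises
  the colour by \<open>n\<close> modulo 3 and ends at the initial colour, whence
  \<open>3 dvd n\<close>.\<close>

lemma cycle:
  obtains n w where "n > 0" "bij_betw w {0..<n} V" "3 dvd n"
    "\<And>i j. i < n \<Longrightarrow> j < n \<Longrightarrow> R (w i) (w j) \<longleftrightarrow> j = Suc i mod n \<or> i = Suc j mod n"
proof -
  obtain x where x: "x \<in> V"
    using ne by blast
  define w where "w i = (nxt ^^ i) x" for i
  have wV: "w i \<in> V" for i
    using funpow_nxt x by (simp add: w_def)
  have w_Suc: "w (Suc i) = nxt (w i)" for i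
    by (simp add: w_def)
  \<comment> \<open>Cancels \<open>k\<close> applications of the injective \<open>nxt\<close>, so
    that the first repetition may be taken at \<open>w 0\<close>.\<close>
  have shift: "w i = w j" if "w (i + k) = w (j + k)" for i j k
    using that by (induction k) (simp_all add: w_Suc inj_on_eq_iff[OF inj_nxt] wV)
  have "\<not> inj w"
    using finite_subset[OF _ fin, of "range w"] wV finite_imageD infinite_UNIV_nat by blast
  then obtain a b where "w a = w b" "a < b"
    unfolding inj_on_def by (metis linorder_neqE_nat)
  then have "w (b - a) = w 0"
    using shift[of 0 a "b - a"] by simp
  then have ex: "\<exists>n. n > 0 \<and> w n = w 0"
    using \<open>a < b\<close> by (intro exI[of _ "b - a"]) auto
  define n where "n = (LEAST n. n > 0 \<and> w n = w 0)"
  have n: "n > 0" "w n = w 0"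
    using LeastI_ex[OF ex] by (auto simp: n_def)
  have least: "\<not> (0 < m \<and> w m = w 0)" if "m < n" for m
    using not_less_Least that by (auto simp: n_def)
  have inj_aux: "i = j" if "i \<le> j" "j < n" "w i = w j" for i j
    using shift[of 0 i "j - i"] least[of "j - i"] that by auto
  have inj: "inj_on w {0..<n}"
    using inj_aux by (intro inj_onI) (metis atLeastLessThan_iff linear)
  have w_mod: "w (Suc i mod n) = nxt (w i)" if "i < n" for i
    using that w_Suc[of i] n by (cases "Suc i = n") auto
  have closed: "y \<in> w ` {0..<n}" if R: "R (w i) y" and i: "i < n" for i y
  proof -
    consider "y = nxt (w i)" | "y \<in> V" "w i = nxt y"
      using R_iff[OF wV, of i y] R by blast
    then show ?thesis
    proof cases
      case 1
      then show ?thesis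
        using w_mod[OF i] n(1) by (intro image_eqI[of _ _ "Suc i mod n"]) simp_all
    next
      case 2
      \<comment> \<open>The cyclic predecessor of \<open>i\<close>: before \<open>0\<close> comes
        \<open>n - 1\<close>.\<close>
      define j where "j = (if i = 0 then n - 1 else i - 1)"
      have j: "j < n" "Suc j mod n = i"
        using i n(1) by (auto simp: j_def)
      then have "nxt (w j) = nxt y"
        using w_mod[of j] 2 by simp
      then have "y = w j"
        using inj_onD[OF inj_nxt, of "w j" y] 2(1) wV by simp
      then show ?thesis
        using j(1) by (intro image_eqI[of _ _ j]) simp_all
    qed
  qed
  have "y \<in> w ` {0..<n}" if "(w 0, y) \<in> {(x, y). R x y}\<^sup>*" for y
    using that by (induction rule: rtrancl_induct) (use n(1) closed in auto)
  then have "w ` {0..<n} = V"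
    using conn wV by blast
  moreover have "3 dvd n"
  proof -
    have "(c x + n) mod 3 = c x mod 3"
      using n(2) funpow_nxt[OF x, of n] colour[of x] by (simp add: w_def)
    then show ?thesis
      by presburger
  qed
  moreover have "R (w i) (w j) \<longleftrightarrow> j = Suc i mod n \<or> i = Suc j mod n" if "i < n" "j < n" for i j
  proof -
    have "w a = nxt (w b) \<longleftrightarrow> a = Suc b mod n" if "a < n" "b < n" for a b
      using inj that w_mod[of b] by (metis atLeastLessThan_iff inj_on_eq_iff le0 mod_less_divisor n(1))
    then show ?thesis
      using R_iff[OF wV] wV that by auto
  qed
  ultimately show ?thesis
    using that[of n w] n(1) inj by (auto simp: bij_betw_def)
qed

end

context two_DP_pairs
begin

text \<open>The vertices that change sides, and those of \<open>P \<inter> P'\<close> next to one.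
  \<open>D \<inter> D'\<close> and the rest of \<open>P \<inter> P'\<close> are left out; the set is
  closed under adjacency, so connectedness shows that nothing is left out in fact.\<close>

definition alternating :: "'v set" where
  "alternating = D \<inter> P' \<union> P \<inter> D' \<union> {x \<in> P \<inter> P'. \<exists>v\<in>D \<inter> P' \<union> P \<inter> D'. R x v}"

lemma alternating_step:
  assumes "x \<in> alternating" "R x y"
  shows "y \<in> alternating"
proof -
  consider "x \<in> D" "x \<in> P'" | "x \<in> P" "x \<in> D'"
    | v where "x \<in> P" "x \<in> P'" "v \<in> D \<inter> P' \<union> P \<inter> D'" "R x v"
    using assms(1) unfolding alternating_def by blast
  then show ?thesis
  proof cases
    case 1
    then have "y \<in> P \<inter> P' \<or> y \<in> P \<inter> D'"
      using D_P'_nbrs[OF 1] assms(2) by metis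
    then show ?thesis
      using 1 sym[OF assms(2)] unfolding alternating_def by blast
  next
    case 2
    then have "y \<in> P \<inter> P' \<or> y \<in> D \<inter> P'"
      using P_D'_nbrs[OF 2] assms(2) by metis
    then show ?thesis
      using 2 sym[OF assms(2)] unfolding alternating_def by blast
  next
    case 3
    then have "y \<in> P \<inter> D' \<or> y \<in> D \<inter> P'"
      using P_P'_nbrs[OF 3] assms(2) by metis
    then show ?thesis
      unfolding alternating_def by blast
  qed
qed

text \<open>Once all vertices are \<open>alternating\<close>, the default colour 2 means exactly
  \<open>P \<inter> P'\<close>, and the neighbour lemmas give each vertex one neighbour of each
  other colour.\<close>

lemma tricoloured:
  assumes "finite V" and conn: "\<And>x y. x \<in> V \<Longrightarrow> y \<in> V \<Longrightarrow> (x, y) \<in> {(x, y). R x y}\<^sup>*"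
    and "D \<noteq> D'"
  shows "tricoloured V R (\<lambda>v. if v \<in> D \<inter> P' then 0 else if v \<in> P \<inter> D' then 1 else 2)"
    (is "tricoloured V R ?c")
proof
  obtain v where v: "v \<in> V" "v \<in> alternating"
    using assms(3) V unfolding alternating_def by blast
  then show "V \<noteq> {}"
    by blast
  have alt: "x \<in> alternating" if "x \<in> V" for x
    using conn[OF v(1) that] by (induction rule: rtrancl_induct) (use v(2) alternating_step in auto)
  fix x
  show "?c x < 3"
    by simp
  have disj: "x \<notin> P'" if "x \<in> D'" for x
    using V that by blast
  have disj': "x \<notin> P" if "x \<in> D" for x
    using V that by blast
  assume "x \<in> V"
  then consider "x \<in> D" "x \<in> P'" | "x \<in> P" "x \<in> D'"
    | v where "x \<in> P" "x \<in> P'" "v \<in> D \<inter> P' \<union> P \<inter> D'" "R x v"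
    using alt unfolding alternating_def by blast
  then show "\<exists>y z. ?c y = Suc (?c x) mod 3 \<and> ?c z = Suc (Suc (?c x)) mod 3 \<and> (\<forall>u. R x u \<longleftrightarrow> u = y \<or> u = z)"
  proof cases
    case 1
    then obtain z y where "z \<in> P \<inter> P'" "y \<in> P \<inter> D'" "\<forall>u. R x u \<longleftrightarrow> u = z \<or> u = y"
      using D_P'_nbrs[OF 1] by blast
    then show ?thesis
      using 1 by (intro exI[of _ y] exI[of _ z]) (auto dest: disj disj')
  next
    case 2
    then obtain y z where "y \<in> P \<inter> P'" "z \<in> D \<inter> P'" "\<forall>u. R x u \<longleftrightarrow> u = y \<or> u = z"
      using P_D'_nbrs[OF 2] by blast
    then show ?thesis
      using 2 by (intro exI[of _ y] exI[of _ z]) (auto dest: disj disj')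
  next
    case 3
    then obtain z y where "z \<in> P \<inter> D'" "y \<in> D \<inter> P'" "\<forall>u. R x u \<longleftrightarrow> u = y \<or> u = z"
      using P_P'_nbrs[OF 3] by blast
    then show ?thesis
      using 3(1,2) by (intro exI[of _ y] exI[of _ z]) (auto dest: disj disj')
  qed
qed (use assms sym in_V in auto)

end

section \<open>Cycle graphs and which of them are minimal\<close>

lemma Suc_mod_inj: "a < n \<Longrightarrow> b < n \<Longrightarrow> Suc a mod n = Suc b mod n \<Longrightarrow> a = b"
  by (auto simp: mod_Suc split: if_splits)

lemma cycle_graph_inj_ends: "3 \<le> n \<Longrightarrow> inj_on (ends (cycle_graph n)) (edges (cycle_graph n))"
  by (auto simp: cycle_graph_def inj_on_def doubleton_eq_iff mod_Suc split: if_splits)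

lemma wf_cycle_graph: "3 \<le> n \<Longrightarrow> wf_mgraph (cycle_graph n)"
  by (auto simp: cycle_graph_def wf_mgraph_def card_insert_if mod_Suc)

lemma wf_ends_adj:
  assumes "wf_mgraph G" "e \<in> edges G"
  obtains x y where "ends G e = {x, y}" "x \<in> verts G" "y \<in> verts G" "adj G x y"
proof -
  have "card (ends G e) = 1 \<or> card (ends G e) = 2"
    using assms by (simp add: wf_mgraph_def)
  then obtain x y where "ends G e = {x, y}"
    by (metis card_1_singletonE card_2_iff insert_absorb2)
  then show ?thesis
    using that[of x y] assms unfolding wf_mgraph_def adj_def by blast
qed

text \<open>The walk \<open>w\<close> along \<open>nxt\<close> numbers the vertices. Since neither
  graph has parallel edges, comparing the sets of end vertices suffices for an isomorphism.\<close>

lemma distinct_DP_pairs_cycle: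
  assumes wf: "wf_mgraph G" and conn: "connected G" and min: "minimal_DPDP_graph G"
    and DP: "DP_pair G D P" "DP_pair G D' P'" and "D \<noteq> D'"
  obtains n w g where "3 dvd n" "3 \<le> n" "iso_map w g (cycle_graph n) G"
proof -
  obtain M M' where "minimal_DP G D P M" "minimal_DP G D' P' M'"
    using minimal_DP_ex wf min DP by metis
  then interpret A: minimal_DP G D P M + B: minimal_DP G D' P' M' .
  interpret two_DP_pairs "verts G" "adj G" D P D' P'
  proof
    show "adj G x y \<Longrightarrow> adj G y x" for x y
      by (simp add: adj_commute)
    show "adj G x y \<Longrightarrow> y \<in> verts G" for x y
      using wf by (auto simp: adj_def wf_mgraph_def)
  qed (fact A.verts_eq B.verts_eq A.disjoint B.disjoint A.adj_D_P B.adj_D_P A.P_nbr B.P_nbr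
    A.mate B.mate A.star B.star)+
  interpret tricoloured "verts G" "adj G" "\<lambda>v. if v \<in> D \<inter> P' then 0 else if v \<in> P \<inter> D' then 1 else 2"
    using wf conn \<open>D \<noteq> D'\<close> by (intro tricoloured) (auto simp: wf_mgraph_def connected_def)
  obtain n w where n: "n > 0" "3 dvd n" and w: "bij_betw w {0..<n} (verts G)"
    and R: "\<And>i j. i < n \<Longrightarrow> j < n \<Longrightarrow> adj G (w i) (w j) \<longleftrightarrow> j = Suc i mod n \<or> i = Suc j mod n"
    using cycle by metis
  have "3 \<le> n"
    using n by (auto elim: dvdE)
  have "(\<lambda>i. w ` {i, Suc i mod n}) ` {0..<n} = ends G ` edges G"
  proof
    show "(\<lambda>i. w ` {i, Suc i mod n}) ` {0..<n} \<subseteq> ends G ` edges G"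
    proof
      fix X assume "X \<in> (\<lambda>i. w ` {i, Suc i mod n}) ` {0..<n}"
      then obtain i where "i < n" "X = {w i, w (Suc i mod n)}"
        by auto
      then show "X \<in> ends G ` edges G"
        using R[of i "Suc i mod n"] n(1) by (auto simp: adj_def)
    qed
    show "ends G ` edges G \<subseteq> (\<lambda>i. w ` {i, Suc i mod n}) ` {0..<n}"
    proof
      fix X assume "X \<in> ends G ` edges G"
      then obtain e where e: "e \<in> edges G" "X = ends G e"
        by blast
      obtain x y where "X = {x, y}" "x \<in> verts G" "y \<in> verts G" "adj G x y"
        using wf_ends_adj[OF wf e(1)] e(2) by metis
      moreover from this obtain i j where "i < n" "x = w i" "j < n" "y = w j"
        using bij_betw_imp_surj_on[OF w] by (metis atLeastLessThan_iff imageE)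
      ultimately have ij: "i < n" "j < n" "X = {w i, w j}" "adj G (w i) (w j)"
        by auto
      then have "X = w ` {i, Suc i mod n} \<or> X = w ` {j, Suc j mod n}"
        using R[of i j] by auto
      then show "X \<in> (\<lambda>i. w ` {i, Suc i mod n}) ` {0..<n}"
        using ij by auto
    qed
  qed
  then have "\<exists>g. iso_map w g (cycle_graph n) G"
    using w cycle_graph_inj_ends[OF \<open>3 \<le> n\<close>] A.inj_ends wf_mgraph_ends[OF wf_cycle_graph[OF \<open>3 \<le> n\<close>]]
    by (intro iso_map_simple) (simp_all add: cycle_graph_def)
  then show ?thesis
    using that n(2) \<open>3 \<le> n\<close> by blast
qed

text \<open>The pattern \<open>DPP\<close> repeated, with \<open>D\<close> at the multiples of 3.
  Edge \<open>i\<close> joins \<open>i\<close> to its successor, so the matching consists of the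
  edges \<open>i\<close> with \<open>i mod 3 = 1\<close>.\<close>

lemma cycle_graph_DPDP:
  assumes "3 dvd n" "3 \<le> n"
  shows "DPDP_graph (cycle_graph n)"
proof -
  let ?G = "cycle_graph n"
  let ?D = "{i. i < n \<and> i mod 3 = 0}" and ?P = "{i. i < n \<and> i mod 3 \<noteq> 0}"
  obtain k where k: "n = 3 * k"
    using assms by blast
  have adj: "adj ?G i (Suc i)" "adj ?G (Suc i) i" if "Suc i < n" for i
    using that by (auto simp: adj_def cycle_graph_def intro!: bexI[of _ i])
  have adj0: "adj ?G 0 (n - 1)"
    using assms by (auto simp: adj_def cycle_graph_def intro!: bexI[of _ "n - 1"])
  have "dominating ?G ?D"
    unfolding dominating_def
  proof (intro conjI ballI)
    fix v assume "v \<in> verts ?G - ?D"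
    then have v: "v < n" "v mod 3 = 1 \<or> v mod 3 = 2"
      by (auto simp: cycle_graph_def)
    then consider "v mod 3 = 1" | "v mod 3 = 2" "v = n - 1" | "v mod 3 = 2" "Suc v < n"
      by linarith
    then show "\<exists>u\<in>?D. adj ?G u v"
    proof cases
      case 1
      then have "0 < v" "(v - 1) mod 3 = 0"
        by presburger+
      then show ?thesis
        using v(1) adj(1)[of "v - 1"] by (intro bexI[of _ "v - 1"]) auto
    next
      case 2
      then show ?thesis
        using adj0 assms by (intro bexI[of _ 0]) auto
    next
      case 3
      then show ?thesis
        using adj(2)[of v] by (intro bexI[of _ "Suc v"]) (auto simp: mod_Suc)
    qed
  qed (auto simp: cycle_graph_def)
  moreover have "dominating ?G ?P"
    unfolding dominating_def
  proof (intro conjI ballI)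
    fix v assume "v \<in> verts ?G - ?P"
    then have v: "v < n" "v mod 3 = 0"
      by (auto simp: cycle_graph_def)
    \<comment> \<open>The last vertex \<open>n - 1\<close> has residue 2, so no wrap-around
      occurs.\<close>
    then have "Suc v < n"
      using k by presburger
    then show "\<exists>u\<in>?P. adj ?G u v"
      using v adj(2)[of v] by (intro bexI[of _ "Suc v"]) (auto simp: mod_Suc)
  qed (auto simp: cycle_graph_def)
  moreover have "has_perfect_matching_induced ?G ?P"
    unfolding has_perfect_matching_induced_def
  proof (intro exI[of _ "{i. i < n \<and> i mod 3 = 1}"] conjI ballI)
    fix e assume "e \<in> {i. i < n \<and> i mod 3 = 1}"
    then have "e < n" "e mod 3 = 1"
      by auto
    moreover from this have "Suc e < n"
      using k by presburger
    ultimately show "card (ends ?G e) = 2" "ends ?G e \<subseteq> ?P"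
      by (auto simp: cycle_graph_def mod_Suc)
  next
    have ends: "ends ?G i = {i, Suc i}" if "i < n" "i mod 3 = 1" for i
    proof -
      have "Suc i < n"
        using k that by presburger
      then show ?thesis
        by (simp add: cycle_graph_def)
    qed
    fix v assume v: "v \<in> ?P"
    show "\<exists>!e. e \<in> {i. i < n \<and> i mod 3 = 1} \<and> v \<in> ends ?G e"
    proof (cases "v mod 3 = 1")
      case True
      then show ?thesis
        using v ends by (intro ex1I[of _ v]) (auto simp: mod_Suc)
    next
      case False
      then have "v mod 3 = 2"
        using v by auto
      then obtain u where "v = Suc u" "u mod 3 = 1"
        by (cases v) (auto simp: mod_Suc split: if_splits)
      then show ?thesis
        using v ends by (intro ex1I[of _ u]) (auto simp: mod_Suc)
    qed
  qed (auto simp: cycle_graph_def)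
  ultimately have "DP_pair ?G ?D ?P"
    by (auto simp: DP_pair_def paired_dominating_def cycle_graph_def)
  then show ?thesis
    by (auto simp: DPDP_graph_def)
qed

text \<open>\<open>D\<close> and \<open>P\<close> follow the pattern \<open>DPPD DPPD D PPD PPD \<dots> PPD\<close>, on three paths left by the
deletion of the edges \<open>3\<close>, \<open>7\<close> and \<open>n - 1\<close>.\<close>
lemma cycle_graph_not_minimal:
  assumes "3 dvd n" "12 \<le> n"
  shows "\<not> minimal_DPDP_graph (cycle_graph n)"
proof -
  \<comment> \<open>What remains are the paths on \<open>0..3\<close>, \<open>4..7\<close> and
    \<open>8..n-1\<close>. The last one has at least four vertices since \<open>12 \<le> n\<close>,
    and both its ends have residue 2, which is why \<open>?D\<close> uses that residue from
    \<open>8\<close> on.\<close>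
  define E where "E = {0..<n} - {3, 7, n - 1}"
  let ?G = "(cycle_graph n)\<lparr>edges := E\<rparr>"
  let ?D = "{i. i < n \<and> (i \<in> {0, 3, 4, 7} \<or> 8 \<le> i \<and> i mod 3 = 2)}"
  let ?P = "{i. i < n \<and> (i \<in> {1, 2, 5, 6} \<or> 8 \<le> i \<and> i mod 3 \<noteq> 2)}"
  let ?M = "{1, 5} \<union> {i. i < n \<and> 8 \<le> i \<and> i mod 3 = 0}"
  obtain k where k: "n = 3 * k"
    using assms by blast
  have ends: "ends ?G i = {i, Suc i}" if "Suc i < n" for i
    using that by (simp add: cycle_graph_def)
  have adj: "adj ?G i (Suc i)" "adj ?G (Suc i) i" if "Suc i < n" "i \<noteq> 3" "i \<noteq> 7" for i
    using that ends by (auto simp: adj_def E_def intro!: bexI[of _ i])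
  have "dominating ?G ?D"
    unfolding dominating_def
  proof (intro conjI ballI)
    fix v assume "v \<in> verts ?G - ?D"
    then have "v < n" "v \<noteq> 0" "v \<noteq> 3" "v \<noteq> 4" "v \<noteq> 7" "8 \<le> v \<longrightarrow> v mod 3 \<noteq> 2"
      by (auto simp: cycle_graph_def)
    then have "(v = 1 \<or> v = 5) \<or> (v = 2 \<or> v = 6) \<or> 9 \<le> v \<and> v mod 3 = 0 \<and> v < n
      \<or> 8 \<le> v \<and> v mod 3 = 1 \<and> v < n"
      by presburger
    then consider "v = 1 \<or> v = 5" | "v = 2 \<or> v = 6" | "9 \<le> v" "v mod 3 = 0" "v < n"
      | "8 \<le> v" "v mod 3 = 1" "v < n"
      by (elim disjE conjE) auto
    then show "\<exists>u\<in>?D. adj ?G u v"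
    proof cases
      case 1
      then show ?thesis
        using adj(1)[of "v - 1"] assms by (intro bexI[of _ "v - 1"]) auto
    next
      case 2
      then show ?thesis
        using adj(2)[of v] assms by (intro bexI[of _ "Suc v"]) auto
    next
      case 3
      then have "(v - 1) mod 3 = 2"
        by (cases v) (auto simp: mod_Suc split: if_splits)
      then show ?thesis
        using adj(1)[of "v - 1"] 3 by (intro bexI[of _ "v - 1"]) auto
    next
      case 4
      moreover from this have "Suc v < n" "Suc v mod 3 = 2"
        using k by presburger+
      ultimately show ?thesis
        using adj(2)[of v] by (intro bexI[of _ "Suc v"]) auto
    qed
  qed (auto simp: cycle_graph_def)
  moreover have "dominating ?G ?P"
    unfolding dominating_def
  proof (intro conjI ballI)
    fix v assume "v \<in> verts ?G - ?P"
    then have "v < n" "v \<noteq> 1" "v \<noteq> 2" "v \<noteq> 5" "v \<noteq> 6" "8 \<le> v \<longrightarrow> v mod 3 = 2"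
      by (auto simp: cycle_graph_def)
    then have "(v = 0 \<or> v = 4) \<or> (v = 3 \<or> v = 7) \<or> v = 8 \<or> 9 \<le> v \<and> v mod 3 = 2 \<and> v < n"
      by presburger
    then consider "v = 0 \<or> v = 4" | "v = 3 \<or> v = 7" | "v = 8" | "9 \<le> v" "v mod 3 = 2" "v < n"
      by (elim disjE conjE) auto
    then show "\<exists>u\<in>?P. adj ?G u v"
    proof cases
      case 1
      then show ?thesis
        using adj(2)[of v] assms by (intro bexI[of _ "Suc v"]) auto
    next
      case 2
      then show ?thesis
        using adj(1)[of "v - 1"] assms by (intro bexI[of _ "v - 1"]) auto
    next
      \<comment> \<open>\<open>8\<close> is the first vertex of the third path: with edge
        \<open>7\<close> deleted, only \<open>9\<close> can dominate it.\<close>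
      case 3
      then show ?thesis
        using adj(2)[of v] assms by (intro bexI[of _ "Suc v"]) auto
    next
      case 4
      then have "(v - 1) mod 3 \<noteq> 2"
        by (cases v) (auto simp: mod_Suc split: if_splits)
      then show ?thesis
        using adj(1)[of "v - 1"] 4 by (intro bexI[of _ "v - 1"]) auto
    qed
  qed (auto simp: cycle_graph_def)
  moreover have "has_perfect_matching_induced ?G ?P"
    unfolding has_perfect_matching_induced_def
  proof (intro exI[of _ ?M] conjI ballI)
    have Suc: "Suc e < n" if "e \<in> ?M" for e
    proof -
      have "e = 1 \<or> e = 5 \<or> e < n \<and> e mod 3 = 0"
        using that by auto
      then show ?thesis
        using k assms(2) by presburger
    qed
    then show "?M \<subseteq> edges ?G"
      by (fastforce simp: E_def)
    show "card (ends ?G e) = 2" if "e \<in> ?M" for e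
      using ends[OF Suc[OF that]] by simp
    show "ends ?G e \<subseteq> ?P" if "e \<in> ?M" for e
      using ends[OF Suc[OF that]] Suc[OF that] that by (auto simp: mod_Suc)
    have mem: "v \<in> ends ?G e \<longleftrightarrow> v = e \<or> v = Suc e" if "e \<in> ?M" for v e
      using ends[OF Suc[OF that]] by simp
    fix v assume v: "v \<in> ?P"
    then have "v \<in> {1, 5} \<or> 8 \<le> v \<and> v mod 3 = 0 \<or> v \<in> {2, 6} \<or> 10 \<le> v \<and> v mod 3 = 1"
      by (simp, presburger)
    \<comment> \<open>Either \<open>v\<close> is the lower end of its matching edge, which then has
      the number \<open>v\<close>, or it is the upper end and the edge has the number of its
      predecessor.\<close>
    then consider "v \<in> ?M" "\<And>u. Suc u = v \<Longrightarrow> u \<notin> ?M" | u where "v = Suc u" "u \<in> ?M" "v \<notin> ?M"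
    proof (elim disjE)
      assume "10 \<le> v \<and> v mod 3 = 1"
      then obtain u where "v = Suc u" "9 \<le> u" "u mod 3 = 0"
        by (cases v) (auto simp: mod_Suc split: if_splits)
      then show ?thesis
        using v by (intro that(2)[of u]) auto
    next
      assume *: "8 \<le> v \<and> v mod 3 = 0"
      then have "u mod 3 \<noteq> 0" if "Suc u = v" for u
        using * that by presburger
      then show ?thesis
        using v * by (intro that(1)) auto
    next
      assume "v \<in> {1, 5}"
      then show ?thesis
        using v by (intro that(1)) auto
    next
      assume "v \<in> {2, 6}"
      then show ?thesis
        using v by (intro that(2)[of "v - 1"]) auto
    qed
    then show "\<exists>!e. e \<in> ?M \<and> v \<in> ends ?G e"
    proof cases
      case 1
      show ?thesis
      proof (rule ex1I[of _ v])
        show "e = v" if "e \<in> ?M \<and> v \<in> ends ?G e" for e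
          using that mem[of e v] 1(2)[of e] by metis
      qed (use 1(1) mem[OF 1(1), of v] in simp)
    next
      case 2
      show ?thesis
      proof (rule ex1I[of _ u])
        show "e = u" if "e \<in> ?M \<and> v \<in> ends ?G e" for e
          using that mem[of e v] 2 by (metis old.nat.inject)
      qed (use 2(1,2) mem[OF 2(2), of v] in simp)
    qed
  qed
  ultimately have "DP_pair ?G ?D ?P"
    by (auto simp: DP_pair_def paired_dominating_def cycle_graph_def)
  then have "DPDP_graph ?G"
    unfolding DPDP_graph_def by (intro exI)
  moreover have "E \<subset> edges (cycle_graph n)"
  proof
    show "E \<subseteq> edges (cycle_graph n)"
      by (simp add: E_def cycle_graph_def)
    have "3 \<in> edges (cycle_graph n)" "3 \<notin> E"
      using assms by (simp_all add: E_def cycle_graph_def)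
    then show "E \<noteq> edges (cycle_graph n)"
      by metis
  qed
  ultimately show ?thesis
    unfolding minimal_DPDP_graph_def by blast
qed

text \<open>Read \<open>b\<close> as membership in \<open>P\<close>. The count of blocks of order
  \<open>3m + 1\<close> excludes these lengths; for fixed \<open>n\<close> it is a finite
  propositional check. The hypotheses ask only for neighbours on the full path, so they also cover
  the deletion of several edges from a cycle.\<close>

lemma no_DP_pattern_on_path:
  fixes b :: "nat \<Rightarrow> bool"
  assumes n: "n \<in> {3, 6, 9}"
    and "\<And>i. i < n \<Longrightarrow> b i \<Longrightarrow> 0 < i \<and> \<not> b (i - 1) \<or> Suc i < n \<and> \<not> b (Suc i)"
    and "\<And>i. i < n \<Longrightarrow> 0 < i \<and> b (i - 1) \<or> Suc i < n \<and> b (Suc i)"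
  shows False
proof -
  note inst = assms(2)[of 0] assms(2)[of 1] assms(2)[of 2] assms(2)[of 3] assms(2)[of 4] assms(2)[of 5]
    assms(2)[of 6] assms(2)[of 7] assms(2)[of 8] assms(3)[of 0] assms(3)[of 1] assms(3)[of 2]
    assms(3)[of 3] assms(3)[of 4] assms(3)[of 5] assms(3)[of 6] assms(3)[of 7] assms(3)[of 8]
  from n consider "n = 3" | "n = 6" | "n = 9"
    by auto
  then show False
  proof cases
    case 1
    then show ?thesis
      using inst by (simp add: eval_nat_numeral) argo
  next
    case 2
    then show ?thesis
      using inst by (simp add: eval_nat_numeral) argo
  next
    case 3
    then show ?thesis
      using inst by (simp add: eval_nat_numeral) argo
  qed
qed

text \<open>A proper edge set misses some edge \<open>k\<close>; what is left lies on a path, where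
  \<open>no_DP_pattern_on_path\<close> applies.\<close>

lemma cycle_graph_minimal:
  assumes n: "n \<in> {3, 6, 9}"
  shows "minimal_DPDP_graph (cycle_graph n)"
  unfolding minimal_DPDP_graph_def
proof (intro conjI allI impI notI)
  show "DPDP_graph (cycle_graph n)"
    using n by (intro cycle_graph_DPDP) auto
  fix E assume E: "E \<subset> edges (cycle_graph n)" "DPDP_graph ((cycle_graph n)\<lparr>edges := E\<rparr>)"
  let ?G = "(cycle_graph n)\<lparr>edges := E\<rparr>"
  obtain D P where DP: "DP_pair ?G D P"
    using E(2) by (auto simp: DPDP_graph_def)
  obtain k where k: "k < n" "k \<notin> E"
    using psubset_imp_ex_mem[OF E(1)] by (auto simp: cycle_graph_def)
  have n0: "0 < n"
    using n by auto
  \<comment> \<open>Numbering that starts right after the missing edge \<open>k\<close>, which joins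
    \<open>p (n - 1)\<close> to \<open>p 0\<close>.\<close>
  define p where "p i = (Suc k + i) mod n" for i
  have p_Suc: "p (Suc i) = Suc (p i) mod n" for i
    by (simp add: p_def mod_Suc_eq)
  have p_less: "p i < n" for i
    using n0 by (simp add: p_def)
  \<comment> \<open>Only this direction is available, as \<open>E\<close> may lack further edges.
    Stepping over either end of the numbering would use the edge \<open>k\<close>.\<close>
  have nbr: "0 < i \<and> y = p (i - 1) \<or> Suc i < n \<and> y = p (Suc i)" if a: "adj ?G (p i) y" and i: "i < n" for i y
  proof -
    obtain x where x: "x \<in> E" "{x, Suc x mod n} = {p i, y}"
      using a by (auto simp: adj_def cycle_graph_def)
    then have "x < n" "x \<noteq> k"
      using E(1) k by (auto simp: cycle_graph_def)
    from x(2) consider "x = p i" "y = Suc x mod n" | "y = x" "p i = Suc x mod n"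
      by (auto simp: doubleton_eq_iff)
    then show ?thesis
    proof cases
      case 1
      have "Suc i \<noteq> n"
      proof
        assume "Suc i = n"
        then have "p i = (k + n) mod n"
          unfolding p_def by (metis add_Suc_shift)
        then show False
          using 1(1) \<open>x \<noteq> k\<close> k by simp
      qed
      then show ?thesis
        using 1 i p_Suc by auto
    next
      case 2
      have "0 < i"
      proof (rule ccontr)
        assume "\<not> 0 < i"
        then have "Suc x mod n = Suc k mod n"
          using 2 by (simp add: p_def)
        then show False
          using Suc_mod_inj \<open>x < n\<close> k \<open>x \<noteq> k\<close> by blast
      qed
      then have "Suc x mod n = Suc (p (i - 1)) mod n"
        using p_Suc[of "i - 1"] 2 by simp
      then show ?thesis
        using Suc_mod_inj[OF \<open>x < n\<close> p_less] 2 \<open>0 < i\<close> by blast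
    qed
  qed
  have V: "D \<inter> P = {}" "x < n \<Longrightarrow> x \<in> D \<or> x \<in> P" for x
    using DP by (auto simp: DP_pair_def cycle_graph_def)
  have D_P: "\<exists>y\<in>P. adj ?G x y" if "x \<in> D" for x
    using DP that by (subst adj_commute) (auto simp: DP_pair_def paired_dominating_def dominating_def)
  have P_D: "\<exists>y\<in>D. adj ?G x y" if "x \<in> P" for x
    using DP that by (subst adj_commute) (auto simp: DP_pair_def dominating_def)
  have P_P: "\<exists>y\<in>P. adj ?G x y" if x: "x \<in> P" for x
  proof -
    obtain M where M: "M \<subseteq> edges ?G" "\<forall>e\<in>M. card (ends ?G e) = 2 \<and> ends ?G e \<subseteq> P"
      "\<forall>v\<in>P. \<exists>!e. e \<in> M \<and> v \<in> ends ?G e"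
      using DP unfolding DP_pair_def paired_dominating_def has_perfect_matching_induced_def by blast
    obtain e where "e \<in> M" "x \<in> ends ?G e"
      using M(3) x by blast
    then have e: "e \<in> edges ?G" "card (ends ?G e) = 2" "ends ?G e \<subseteq> P" "x \<in> ends ?G e"
      using M(1,2) by blast+
    from e(2,4) obtain y where "ends ?G e = {x, y}"
      by (rule card_2_other)
    then show ?thesis
      using e unfolding adj_def by blast
  qed
  show False
  proof (rule no_DP_pattern_on_path[OF n, of "\<lambda>i. p i \<in> P"])
    fix i assume i: "i < n"
    show "0 < i \<and> p (i - 1) \<in> P \<or> Suc i < n \<and> p (Suc i) \<in> P"
      using D_P[of "p i"] P_P[of "p i"] V(2)[OF p_less, of i] nbr[OF _ i] by metis
    show "0 < i \<and> p (i - 1) \<notin> P \<or> Suc i < n \<and> p (Suc i) \<notin> P" if "p i \<in> P"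
      using P_D[OF that] V(1) nbr[OF _ i] by blast
  qed
qed

subsection \<open>The 2-subdivision graph\<close>

text \<open>A loop adds two to the degree, so degree one leaves no loop and exactly one other
  edge.\<close>

lemma leaf_edge_unique:
  assumes wf: "wf_mgraph H" and v: "v \<in> leaves H"
  shows "\<exists>e. e \<in> edges H \<and> v \<in> ends H e \<and> card (ends H e) = 2 \<and>
             (\<forall>e'\<in>edges H. v \<in> ends H e' \<longrightarrow> e' = e)"
proof -
  let ?A = "{e \<in> edges H. v \<in> ends H e \<and> card (ends H e) = 2}"
  let ?B = "{e \<in> edges H. ends H e = {v}}"
  have "finite ?B"
    using wf by (simp add: wf_mgraph_def)
  have "card ?A + 2 * card ?B = 1"
    using v by (simp add: leaves_def degree_def)
  then have "card ?A = 1" "card ?B = 0"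
    by presburger+
  then have B: "?B = {}"
    using \<open>finite ?B\<close> by simp
  obtain e where A: "?A = {e}"
    using \<open>card ?A = 1\<close> by (rule card_1_singletonE)
  have "e' = e" if "e' \<in> edges H" "v \<in> ends H e'" for e'
  proof -
    have "card (ends H e') \<noteq> 1"
    proof
      assume "card (ends H e') = 1"
      then have "e' \<in> ?B"
        using that by (metis (mono_tags, lifting) card_1_singletonE mem_Collect_eq singletonD)
      then show False
        using B by blast
    qed
    then have "e' \<in> ?A"
      using that wf by (auto simp: wf_mgraph_def)
    then show ?thesis
      using A by blast
  qed
  moreover have "e \<in> ?A"
    using A by blast
  ultimately show ?thesis
    by blast
qed

lemma leaf_edge:
  assumes "wf_mgraph H" "v \<in> leaves H"
  shows "leaf_edge H v \<in> edges H" "v \<in> ends H (leaf_edge H v)" "card (ends H (leaf_edge H v)) = 2"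
    and leaf_edge_eqI: "\<And>e. e \<in> edges H \<Longrightarrow> v \<in> ends H e \<Longrightarrow> e = leaf_edge H v"
proof -
  obtain e where e: "e \<in> edges H" "v \<in> ends H e" "card (ends H e) = 2"
    and uniq: "\<And>e'. e' \<in> edges H \<Longrightarrow> v \<in> ends H e' \<Longrightarrow> e' = e"
    using leaf_edge_unique[OF assms] by blast
  have "leaf_edge H v = e"
    unfolding leaf_edge_def using e uniq by (intro some_equality) blast+
  then show "leaf_edge H v \<in> edges H" "v \<in> ends H (leaf_edge H v)" "card (ends H (leaf_edge H v)) = 2"
    using e by simp_all
  show "e' = leaf_edge H v" if "e' \<in> edges H" "v \<in> ends H e'" for e'
    using uniq[OF that] \<open>leaf_edge H v = e\<close> by simp
qed

lemma S2_sel [simp]: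
  "verts (S2 H \<alpha>) = S2_old H \<alpha> \<union> S2_new H" "ends (S2 H \<alpha>) = S2_ends H"
  by (simp_all add: S2_def)

lemma S2_edges_simps [simp]:
  "Mid e \<in> edges (S2 H \<alpha>) \<longleftrightarrow> e \<in> edges H"
  "Att e v \<in> edges (S2 H \<alpha>) \<longleftrightarrow> e \<in> edges H \<and> card (ends H e) = 2 \<and> v \<in> ends H e \<and> v \<notin> leaves H"
  "LAtt e i \<in> edges (S2 H \<alpha>) \<longleftrightarrow> e \<in> edges H \<and> card (ends H e) = 1 \<and> i \<in> {1, 2}"
  "LfAtt v i \<in> edges (S2 H \<alpha>) \<longleftrightarrow> v \<in> leaves H \<and> 1 \<le> i \<and> i \<le> \<alpha> v"
  by (auto simp: S2_def)

lemma S2_edge_cases: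
  assumes "x \<in> edges (S2 H \<alpha>)"
  obtains e where "x = Mid e" "e \<in> edges H"
    | e v where "x = Att e v" "e \<in> edges H" "card (ends H e) = 2" "v \<in> ends H e" "v \<notin> leaves H"
    | e i where "x = LAtt e i" "e \<in> edges H" "card (ends H e) = 1" "i \<in> {1, 2}"
    | v i where "x = LfAtt v i" "v \<in> leaves H" "1 \<le> i" "i \<le> \<alpha> v"
proof (cases x)
  case Mid
  then show ?thesis
    using assms that(1) by simp
next
  case Att
  then show ?thesis
    using assms that(2) by simp
next
  case LAtt
  then show ?thesis
    using assms that(3) by simp
next
  case LfAtt
  then show ?thesis
    using assms that(4) by simp
qed

lemma S2_old_simps [simp]:
  "Old v \<in> S2_old H \<alpha> \<longleftrightarrow> v \<in> verts H \<and> v \<notin> leaves H"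
  "Cp v i \<in> S2_old H \<alpha> \<longleftrightarrow> v \<in> leaves H \<and> 1 \<le> i \<and> i \<le> \<alpha> v"
  "Nw e v \<notin> S2_old H \<alpha>" "Lp e i \<notin> S2_old H \<alpha>"
  by (auto simp: S2_old_def)

lemma S2_new_simps [simp]:
  "Old v \<notin> S2_new H" "Cp v i \<notin> S2_new H"
  "Nw e v \<in> S2_new H \<longleftrightarrow> e \<in> edges H \<and> card (ends H e) = 2 \<and> v \<in> ends H e"
  "Lp e i \<in> S2_new H \<longleftrightarrow> e \<in> edges H \<and> card (ends H e) = 1 \<and> i \<in> {1, 2}"
  by (auto simp: S2_new_def)

text \<open>A leaf lies on no loop, so the vertex \<open>Old v\<close> to which the new vertices of
  a loop are attached does exist.\<close>

lemma loop_end: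
  assumes wf: "wf_mgraph H" and "e \<in> edges H" "card (ends H e) = 1"
  obtains v where "ends H e = {v}" "v \<in> verts H" "v \<notin> leaves H"
proof -
  obtain v where v: "ends H e = {v}"
    using assms(3) by (rule card_1_singletonE)
  have "v \<notin> leaves H"
  proof
    assume l: "v \<in> leaves H"
    then have "e = leaf_edge H v"
      using leaf_edge_eqI[OF wf l assms(2)] v by simp
    then show False
      using leaf_edge(3)[OF wf l] assms(3) by simp
  qed
  moreover have "v \<in> verts H"
    using wf v assms(2) by (auto simp: wf_mgraph_def)
  ultimately show ?thesis
    using that v by blast
qed

lemma S2_ends_in_verts:
  assumes wf: "wf_mgraph H"
  shows "\<forall>x\<in>edges (S2 H \<alpha>). ends (S2 H \<alpha>) x \<subseteq> verts (S2 H \<alpha>)"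
proof
  fix x assume "x \<in> edges (S2 H \<alpha>)"
  then show "ends (S2 H \<alpha>) x \<subseteq> verts (S2 H \<alpha>)"
  proof (cases rule: S2_edge_cases)
    case (1 e)
    then have "card (ends H e) = 1 \<or> card (ends H e) = 2"
      using wf by (simp add: wf_mgraph_def)
    then show ?thesis
      using 1 by auto
  next
    case (2 e v)
    then show ?thesis
      using wf by (auto simp: wf_mgraph_def)
  next
    case (3 e i)
    obtain v where "ends H e = {v}" "v \<in> verts H" "v \<notin> leaves H"
      using loop_end[OF wf 3(2,3)] .
    then show ?thesis
      using 3 by simp
  next
    case (4 v i)
    then show ?thesis
      using leaf_edge(1-3)[OF wf 4(2)] by simp
  qed
qed

lemma S2_ends_Mid: "S2_ends H (Mid e) \<subseteq> range (Nw e) \<union> range (Lp e)"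
  by auto

lemma S2_ends_Mid_not_old: "z \<in> S2_ends H (Mid e) \<Longrightarrow> z \<notin> S2_old H \<alpha>"
  using S2_ends_Mid[of H e] by auto

text \<open>Subdivision separates parallel edges and loops of \<open>H\<close>: new vertices carry
  the name of their edge, so the ends of a middle edge reveal it, and every other edge is determined
  by its new vertex or its copy of a leaf.\<close>

lemma S2_inj_ends:
  assumes wf: "wf_mgraph H"
  shows "inj_on (ends (S2 H \<alpha>)) (edges (S2 H \<alpha>))"
proof (rule inj_onI)
  have Mid: "x = y" if eq: "S2_ends H x = S2_ends H y" and x: "x = Mid e" and e: "e \<in> edges H" for x y e
  proof -
    have "ends H e \<noteq> {}"
      using wf e by (auto simp: wf_mgraph_def)
    then have "S2_ends H (Mid e) \<noteq> {}"
      by simp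
    then obtain z where "z \<in> S2_ends H x"
      using x by blast
    then have z: "z \<in> range (Nw e) \<union> range (Lp e)" "z \<in> S2_ends H y"
      using eq x S2_ends_Mid[of H e] by blast+
    have y: "S2_ends H y \<subseteq> range (Nw e) \<union> range (Lp e)"
      using eq x S2_ends_Mid[of H e] by blast
    show ?thesis
    proof (cases y)
      case (Mid e')
      then show ?thesis
        using z x S2_ends_Mid[of H e'] by blast
    qed (use y in auto)
  qed
  fix x y assume x: "x \<in> edges (S2 H \<alpha>)" and y: "y \<in> edges (S2 H \<alpha>)"
    and eq: "ends (S2 H \<alpha>) x = ends (S2 H \<alpha>) y"
  from x show "x = y"
  proof (cases rule: S2_edge_cases)
    case (1 e)
    then show ?thesis
      using Mid eq by simp
  next
    case 2
    from y show ?thesis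
    proof (cases rule: S2_edge_cases)
      case (1 e)
      then show ?thesis
        using Mid[of y x] eq by simp
    qed (use 2 eq in \<open>auto simp: doubleton_eq_iff\<close>)
  next
    case 3
    from y show ?thesis
    proof (cases rule: S2_edge_cases)
      case (1 e)
      then show ?thesis
        using Mid[of y x] eq by simp
    qed (use 3 eq in \<open>auto simp: doubleton_eq_iff\<close>)
  next
    case 4
    from y show ?thesis
    proof (cases rule: S2_edge_cases)
      case (1 e)
      then show ?thesis
        using Mid[of y x] eq by simp
    qed (use 4 eq in \<open>auto simp: doubleton_eq_iff\<close>)
  qed
qed

lemma DP_pair_mono:
  assumes "DP_pair (G\<lparr>edges := E\<rparr>) D P" and E: "E \<subseteq> edges G"
  shows "DP_pair G D P"
proof -
  have adj: "adj G u v" if "adj (G\<lparr>edges := E\<rparr>) u v" for u v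
    using that E by (auto simp: adj_def)
  have dom: "dominating G X" if "dominating (G\<lparr>edges := E\<rparr>) X" for X
    using that adj unfolding dominating_def by fastforce
  have "has_perfect_matching_induced G P" if "has_perfect_matching_induced (G\<lparr>edges := E\<rparr>) P"
  proof -
    from that obtain M where M: "M \<subseteq> E" "\<forall>e\<in>M. card (ends G e) = 2 \<and> ends G e \<subseteq> P"
      "\<forall>v\<in>P. \<exists>!e. e \<in> M \<and> v \<in> ends G e"
      by (auto simp: has_perfect_matching_induced_def)
    then show ?thesis
      unfolding has_perfect_matching_induced_def using E by (intro exI[of _ M]) simp
  qed
  then show ?thesis
    using assms(1) dom by (simp add: DP_pair_def paired_dominating_def)
qed

text \<open>Each edge is the only one that serves one of its ends: a middle edge is the only edge at a new
vertex inside the new vertices, any other edge the only one joining its new vertex (or its leaf) to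
the other part.\<close>
lemma S2_edges_needed:
  assumes wf: "wf_mgraph H" and E: "E \<subseteq> edges (S2 H \<alpha>)"
    and DP: "DP_pair ((S2 H \<alpha>)\<lparr>edges := E\<rparr>) (S2_old H \<alpha>) (S2_new H)"
  shows "E = edges (S2 H \<alpha>)"
proof
  have old: "\<exists>u\<in>S2_old H \<alpha>. \<exists>x\<in>E. S2_ends H x = {u, v}" if "v \<in> S2_new H" "v \<notin> S2_old H \<alpha>" for v
    using DP that by (auto simp: DP_pair_def dominating_def adj_def)
  have new: "\<exists>u\<in>S2_new H. \<exists>x\<in>E. S2_ends H x = {u, v}" if "v \<in> S2_old H \<alpha>" "v \<notin> S2_new H" for v
    using DP that by (auto simp: DP_pair_def paired_dominating_def dominating_def adj_def)
  have "has_perfect_matching_induced ((S2 H \<alpha>)\<lparr>edges := E\<rparr>) (S2_new H)"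
    using DP by (simp add: DP_pair_def paired_dominating_def)
  then obtain M where M: "M \<subseteq> E" "\<forall>x\<in>M. card (S2_ends H x) = 2 \<and> S2_ends H x \<subseteq> S2_new H"
    "\<forall>v\<in>S2_new H. \<exists>!x. x \<in> M \<and> v \<in> S2_ends H x"
    by (auto simp: has_perfect_matching_induced_def)
  show "edges (S2 H \<alpha>) \<subseteq> E"
  proof
    fix x assume "x \<in> edges (S2 H \<alpha>)"
    then show "x \<in> E"
    proof (cases rule: S2_edge_cases)
      case (1 e)
      have "card (ends H e) = 1 \<or> card (ends H e) = 2"
        using wf 1 by (simp add: wf_mgraph_def)
      then obtain z where z: "z \<in> S2_new H" "z \<in> range (Nw e) \<union> range (Lp e)"
      proof
        assume "card (ends H e) = 1"
        then show ?thesis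
          using 1 that[of "Lp e 1"] by simp
      next
        assume *: "card (ends H e) = 2"
        then obtain u where "u \<in> ends H e"
          by fastforce
        then show ?thesis
          using 1 * that[of "Nw e u"] by simp
      qed
      obtain y where y: "y \<in> M" "z \<in> S2_ends H y"
        using M(3) z(1) by blast
      then have "y \<in> edges (S2 H \<alpha>)"
        using M(1) E by blast
      moreover have new: "S2_ends H y \<subseteq> S2_new H"
        using M(2) y(1) by blast
      \<comment> \<open>All other kinds of edges have an end among the old vertices.\<close>
      ultimately have "y = Mid e"
      proof (cases rule: S2_edge_cases)
        case (1 e')
        then show ?thesis
          using y(2) z(2) S2_ends_Mid[of H e'] by blast
      qed (use new in simp_all)
      then show ?thesis
        using 1 y(1) M(1) by blast
    next
      case (2 e v)
      then obtain u y where u: "u \<in> S2_old H \<alpha>" "y \<in> E" "S2_ends H y = {u, Nw e v}"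
        using old[of "Nw e v"] by auto
      then have "y \<in> edges (S2 H \<alpha>)"
        using E by blast
      then have "y = Att e v"
      proof (cases rule: S2_edge_cases)
        case (1 e')
        then show ?thesis
          using u S2_ends_Mid_not_old[of u H e' \<alpha>] by simp
      qed (use 2 u in \<open>auto simp: doubleton_eq_iff\<close>)
      then show ?thesis
        using 2 u by simp
    next
      case (3 e i)
      then obtain u y where u: "u \<in> S2_old H \<alpha>" "y \<in> E" "S2_ends H y = {u, Lp e i}"
        using old[of "Lp e i"] by auto
      then have "y \<in> edges (S2 H \<alpha>)"
        using E by blast
      then have "y = LAtt e i"
      proof (cases rule: S2_edge_cases)
        case (1 e')
        then show ?thesis
          using u S2_ends_Mid_not_old[of u H e' \<alpha>] by simp
      qed (use 3 u in \<open>auto simp: doubleton_eq_iff\<close>)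
      then show ?thesis
        using 3 u by simp
    next
      case (4 v i)
      then obtain u y where u: "u \<in> S2_new H" "y \<in> E" "S2_ends H y = {u, Cp v i}"
        using new[of "Cp v i"] by auto
      then have "y \<in> edges (S2 H \<alpha>)"
        using E by blast
      then have "y = LfAtt v i"
      proof (cases rule: S2_edge_cases)
        case (1 e')
        then show ?thesis
          using u 4 S2_ends_Mid_not_old[of "Cp v i" H e' \<alpha>] by simp
      qed (use 4 u in \<open>auto simp: doubleton_eq_iff\<close>)
      then show ?thesis
        using 4 u by simp
    qed
  qed
qed (rule E)

text \<open>A DP-pair of a spanning subgraph is one of the whole graph, hence by uniqueness the pair
  of old and new vertices, for which no edge can be missing.\<close>

lemma S2_minimal:
  assumes wf: "wf_mgraph H"
    and uniq: "\<And>D P. DP_pair (S2 H \<alpha>) D P \<longleftrightarrow> D = S2_old H \<alpha> \<and> P = S2_new H"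
  shows "minimal_DPDP_graph (S2 H \<alpha>)"
  unfolding minimal_DPDP_graph_def
proof (intro conjI allI impI notI)
  show "DPDP_graph (S2 H \<alpha>)"
    using uniq unfolding DPDP_graph_def by blast
  fix E assume E: "E \<subset> edges (S2 H \<alpha>)" "DPDP_graph ((S2 H \<alpha>)\<lparr>edges := E\<rparr>)"
  then obtain D P where DP: "DP_pair ((S2 H \<alpha>)\<lparr>edges := E\<rparr>) D P"
    unfolding DPDP_graph_def by blast
  then have "DP_pair (S2 H \<alpha>) D P"
    using DP_pair_mono E(1) by blast
  then have "D = S2_old H \<alpha>" "P = S2_new H"
    using uniq by blast+
  then show False
    using S2_edges_needed[OF wf _, of E \<alpha>] DP E(1) by blast
qed

subsection \<open>Recovering the graph from a DP-pair\<close>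

text \<open>In a minimal DPDP-graph the vertices of \<open>H\<close> are the representatives \<open>r p \<in> D\<close>, one for each
\<open>p \<in> P\<close>, and the edges of \<open>H\<close> are the matching edges. The leaves of \<open>G\<close> at a common \<open>p\<close> are the
copies of the leaf \<open>r p\<close> of \<open>H\<close>.\<close>
context minimal_DP
begin

text \<open>If \<open>p\<close> has several neighbours in \<open>D\<close>, an arbitrary one names
  the star centred at \<open>p\<close>. If the star is centred in \<open>D\<close>, this is its
  centre, by \<open>centre\<close>.\<close>

definition r :: "'v \<Rightarrow> 'v" where
  "r p = (SOME d. d \<in> D \<and> adj G d p)"

text \<open>Representatives and matching edges keep their names, so \<open>H\<close> has the types
  of \<open>G\<close>. A matching edge whose ends share a representative becomes a loop.\<close>

definition H :: "('v, 'e) mgraph" where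
  "H = \<lparr>verts = r ` P, edges = M, ends = (\<lambda>e. r ` ends G e)\<rparr>"

lemma H_sel [simp]: "verts H = r ` P" "edges H = M" "ends H e = r ` ends G e"
  by (simp_all add: H_def)

lemma r: "p \<in> P \<Longrightarrow> r p \<in> D" "p \<in> P \<Longrightarrow> adj G (r p) p"
proof -
  assume "p \<in> P"
  then have "\<exists>d. d \<in> D \<and> adj G d p"
    using P_nbr[of p] by (auto simp: adj_commute[of G p])
  then have "r p \<in> D \<and> adj G (r p) p"
    unfolding r_def by (rule someI_ex)
  then show "r p \<in> D" "adj G (r p) p"
    by blast+
qed

text \<open>The second neighbour \<open>p'\<close> rules out the second alternative of
  \<open>star\<close>.\<close>

lemma centre:
  assumes "v \<in> D" "adj G v p" "adj G v p'" "p \<noteq> p'"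
  shows "d \<in> D \<Longrightarrow> adj G d p \<Longrightarrow> d = v" "r p = v"
proof -
  have "p \<in> P"
    using adj_D_P assms by blast
  have *: "\<forall>d\<in>D. adj G d p \<longrightarrow> d = v"
    using star[OF assms(1) \<open>p \<in> P\<close> assms(2)] assms(3,4) by blast
  then show "d \<in> D \<Longrightarrow> adj G d p \<Longrightarrow> d = v"
    by blast
  show "r p = v"
    using * r[OF \<open>p \<in> P\<close>] by blast
qed

definition matching_edge :: "'v \<Rightarrow> 'e" where
  "matching_edge p = (THE e. e \<in> M \<and> p \<in> ends G e)"

lemma matching_edge: "p \<in> P \<Longrightarrow> matching_edge p \<in> M" "p \<in> P \<Longrightarrow> p \<in> ends G (matching_edge p)"
  using theI'[OF M_unique[of p]] unfolding matching_edge_def by simp_all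

lemma M_in_P: "e \<in> M \<Longrightarrow> p \<in> ends G e \<Longrightarrow> p \<in> P"
  using M_ends[of e] by blast

lemma matching_edge_eqI: "e \<in> M \<Longrightarrow> p \<in> ends G e \<Longrightarrow> matching_edge p = e"
  unfolding matching_edge_def using M_in_P[of e p] by (intro the1_equality M_unique) simp_all

lemma finite_M_ends: "e \<in> M \<Longrightarrow> finite (ends G e)"
  using M_ends[of e] by (simp add: card_ge_0_finite)

lemma card_H_ends: "e \<in> M \<Longrightarrow> card (ends H e) = 1 \<or> card (ends H e) = 2"
proof -
  assume e: "e \<in> M"
  have "card (r ` ends G e) \<le> 2"
    using card_image_le[OF finite_M_ends[OF e], of r] M_ends[OF e] by simp
  moreover have "ends G e \<noteq> {}"
    using M_ends[OF e] by auto
  then have "card (r ` ends G e) \<noteq> 0"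
    using finite_M_ends[OF e] by simp
  ultimately show ?thesis
    by auto
qed

lemma r_inj: "e \<in> M \<Longrightarrow> card (ends H e) = 2 \<Longrightarrow> inj_on r (ends G e)"
  using M_ends[of e] finite_M_ends[of e] by (intro eq_card_imp_inj_on) simp_all

lemma wf_H: "wf_mgraph H"
proof -
  have "finite (edges G)" "finite (verts G)"
    using wf by (simp_all add: wf_mgraph_def)
  then have "finite M" "finite P"
    using M_edges verts_eq by (auto intro: finite_subset)
  then show ?thesis
    unfolding wf_mgraph_def using card_H_ends M_in_P by auto
qed

text \<open>The matching edges of \<open>p\<close> and \<open>p'\<close> both contain
  \<open>v\<close> in \<open>H\<close>, so both are the edge at the leaf \<open>v\<close>. That edge
  is not a loop, hence \<open>r\<close> is injective on its ends.\<close>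

lemma leaves_H_unique:
  assumes "v \<in> leaves H" "p \<in> P" "r p = v" "p' \<in> P" "r p' = v"
  shows "p = p'"
proof -
  have "matching_edge q = leaf_edge H v" if "q \<in> P" "r q = v" for q
    using leaf_edge_eqI[OF wf_H assms(1), of "matching_edge q"] matching_edge[OF that(1)] that(2) by auto
  then have e: "p \<in> ends G (leaf_edge H v)" "p' \<in> ends G (leaf_edge H v)"
    using assms matching_edge by metis+
  have "inj_on r (ends G (leaf_edge H v))"
    using leaf_edge(1-3)[OF wf_H assms(1)] by (intro r_inj) simp_all
  then show ?thesis
    by (rule inj_onD) (use e assms(3,5) in simp_all)
qed

text \<open>Every edge of \<open>H\<close> at \<open>r p\<close> comes from a matching edge
  containing \<open>p\<close>, and there is only one. It is no loop, as its other end has another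
  representative.\<close>

lemma leaves_HI:
  assumes p: "p \<in> P" and uniq: "\<And>p'. p' \<in> P \<Longrightarrow> r p' = r p \<Longrightarrow> p' = p"
  shows "r p \<in> leaves H"
proof -
  obtain q where q: "ends G (matching_edge p) = {p, q}" "q \<noteq> p"
    using M_ends[OF matching_edge(1)[OF p]] matching_edge(2)[OF p] card_2_other by metis
  have "q \<in> P"
    using M_in_P[OF matching_edge(1)[OF p], of q] q by simp
  then have "r q \<noteq> r p"
    using uniq q by blast
  then have card: "card (r ` ends G (matching_edge p)) = 2"
    using q by simp
  have A: "{e \<in> M. r p \<in> r ` ends G e \<and> card (r ` ends G e) = 2} = {matching_edge p}"
  proof
    show "{e \<in> M. r p \<in> r ` ends G e \<and> card (r ` ends G e) = 2} \<subseteq> {matching_edge p}"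
    proof
      fix e assume e: "e \<in> {e \<in> M. r p \<in> r ` ends G e \<and> card (r ` ends G e) = 2}"
      then obtain p' where "p' \<in> ends G e" "r p' = r p"
        by auto
      then have "p \<in> ends G e"
        using uniq M_in_P[of e] e by blast
      then show "e \<in> {matching_edge p}"
        using matching_edge_eqI[of e p] e by simp
    qed
  qed (use card matching_edge[OF p] in auto)
  have B: "{e \<in> M. r ` ends G e = {r p}} = {}"
  proof (rule equals0I)
    fix e assume e: "e \<in> {e \<in> M. r ` ends G e = {r p}}"
    then have "p' = p" if "p' \<in> ends G e" for p'
      using uniq[of p'] M_in_P[of e p'] that by blast
    then have "ends G e \<subseteq> {p}"
      by blast
    then show False
      using M_ends[of e] e card_mono[of "{p}" "ends G e"] by simp
  qed
  have "degree H (r p) = 1"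
    unfolding degree_def H_sel A B by simp
  then show ?thesis
    using p by (simp add: leaves_def)
qed

text \<open>Another \<open>p'\<close> with the same representative would make \<open>r p\<close> a
  centre with two neighbours. Then \<open>d\<close> would be that centre, although it has only one
  neighbour.\<close>

lemma pendant_leaf:
  assumes "d \<in> D" "adj G d p" and only: "\<And>p'. adj G d p' \<Longrightarrow> p' = p"
  shows "r p \<in> leaves H"
proof (rule leaves_HI)
  show p: "p \<in> P"
    using adj_D_P assms by blast
  fix p' assume p': "p' \<in> P" "r p' = r p"
  show "p' = p"
  proof (rule ccontr)
    assume "p' \<noteq> p"
    then have "d = r p"
      using centre(1)[OF r(1)[OF p] r(2)[OF p], of p' d] r(2)[OF p'(1)] p'(2) assms(1,2) by simp
    then show False
      using only[of p'] r(2)[OF p'(1)] p'(2) \<open>p' \<noteq> p\<close> by metis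
  qed
qed

lemma leaf_pendant:
  assumes "p \<in> P" "r p \<in> leaves H" "d \<in> D" "adj G d p" "adj G d p'"
  shows "p' = p"
proof (rule ccontr)
  assume "p' \<noteq> p"
  have "p' \<in> P"
    using adj_D_P assms by blast
  have "r p = d" "r p' = d"
    using centre(2) assms \<open>p' \<noteq> p\<close> by metis+
  then show False
    using leaves_H_unique[OF assms(2,1) _ \<open>p' \<in> P\<close>] \<open>p' \<noteq> p\<close> by simp
qed

lemma nonleaf_two:
  assumes "p \<in> P" "r p \<notin> leaves H"
  obtains p' where "p' \<noteq> p" "p' \<in> P" "adj G (r p) p'"
proof -
  obtain p' where "p' \<in> P" "r p' = r p" "p' \<noteq> p"
    using leaves_HI[OF assms(1)] assms(2) by blast
  then show ?thesis
    using that r(2)[of p'] by simp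
qed

definition support :: "'v \<Rightarrow> 'v" where
  "support v = (SOME p. p \<in> P \<and> r p = v)"

text \<open>For a leaf \<open>v\<close> of \<open>H\<close> these are the vertices of
  \<open>D\<close> in the star of \<open>support v\<close>. They include \<open>v\<close> itself,
  which yields \<open>\<alpha>_pos\<close>.\<close>

definition pendants :: "'v \<Rightarrow> 'v set" where
  "pendants v = {d \<in> D. adj G d (support v)}"

text \<open>An arbitrary enumeration, starting at 1 to match the indices of the copies of a
  leaf.\<close>

definition pendant :: "'v \<Rightarrow> nat \<Rightarrow> 'v" where
  "pendant v = (SOME f. bij_betw f {1..card (pendants v)} (pendants v))"

definition \<alpha> :: "'v \<Rightarrow> nat" where
  "\<alpha> v = card (pendants v)"

lemma support:
  assumes "v \<in> leaves H"
  shows "support v \<in> P" "r (support v) = v"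
proof -
  have "\<exists>p. p \<in> P \<and> r p = v"
    using assms by (auto simp: leaves_def)
  then have "support v \<in> P \<and> r (support v) = v"
    unfolding support_def by (rule someI_ex)
  then show "support v \<in> P" "r (support v) = v"
    by blast+
qed

lemma support_eqI: "r p \<in> leaves H \<Longrightarrow> p \<in> P \<Longrightarrow> support (r p) = p"
  using support[of "r p"] leaves_H_unique[of "r p" "support (r p)" p] by simp

lemma finite_pend: "finite (pendants v)"
  using wf verts_eq by (auto simp: pendants_def wf_mgraph_def)

lemma pendant: "bij_betw (pendant v) {1..\<alpha> v} (pendants v)"
  unfolding pendant_def \<alpha>_def using someI_ex[OF ex_bij_betw_nat_finite_1[OF finite_pend]] .

lemma pendant_in: "1 \<le> i \<Longrightarrow> i \<le> \<alpha> v \<Longrightarrow> pendant v i \<in> pendants v"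
  using pendant[of v] by (auto simp: bij_betw_def)

lemma pendants_pendant: "d \<in> pendants v \<Longrightarrow> \<exists>i\<in>{1..\<alpha> v}. d = pendant v i"
  using bij_betw_imp_surj_on[OF pendant[of v]] by (metis imageE)

lemma \<alpha>_pos: "v \<in> leaves H \<Longrightarrow> 1 \<le> \<alpha> v"
proof -
  assume "v \<in> leaves H"
  then have "v \<in> pendants v"
    using support[of v] r[of "support v"] by (simp add: pendants_def)
  then have "card (pendants v) \<noteq> 0"
    using finite_pend by auto
  then show ?thesis
    by (simp add: \<alpha>_def)
qed

section \<open>The isomorphism from the 2-subdivision graph onto the given graph\<close>

text \<open>With \<open>end2\<close> an arbitrary orientation of the matching edge. It is needed for
  the loops of \<open>H\<close>, where the representative does not tell the two ends apart.\<close>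

definition end1 :: "'e \<Rightarrow> 'v" where
  "end1 e = (SOME x. x \<in> ends G e)"

definition end2 :: "'e \<Rightarrow> 'v" where
  "end2 e = (SOME y. ends G e = {end1 e, y})"

lemma ends_end12: "e \<in> M \<Longrightarrow> ends G e = {end1 e, end2 e}" "e \<in> M \<Longrightarrow> end1 e \<noteq> end2 e"
proof -
  assume e: "e \<in> M"
  then have "ends G e \<noteq> {}"
    using M_ends[OF e] by auto
  then have "end1 e \<in> ends G e"
    unfolding end1_def by (rule some_in_eq[THEN iffD2])
  then have "\<exists>y. ends G e = {end1 e, y}"
    using M_ends[OF e] card_2_other by metis
  then show *: "ends G e = {end1 e, end2 e}"
    unfolding end2_def by (rule someI_ex)
  then show "end1 e \<noteq> end2 e"
    using M_ends[OF e] by auto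
qed

text \<open>The inverse of the contraction. For a non-loop \<open>e\<close> of \<open>H\<close> the
  end represented by \<open>u\<close> is unique, by \<open>r_inj\<close>.\<close>

primrec h :: "('v, 'e) s2v \<Rightarrow> 'v" where
  "h (Old v) = v"
| "h (Cp v i) = pendant v i"
| "h (Nw e u) = (THE p. p \<in> ends G e \<and> r p = u)"
| "h (Lp e i) = (if i = 1 then end1 e else end2 e)"

lemma h_Nw:
  assumes "e \<in> M" "card (ends H e) = 2" "p \<in> ends G e"
  shows "h (Nw e (r p)) = p"
  using assms(3) r_inj[OF assms(1,2)] by (auto intro!: the_equality simp: inj_on_eq_iff)

text \<open>The number of neighbours separates the two kinds: \<open>Old\<close> gives the vertices
  of \<open>D\<close> with at least two neighbours, \<open>Cp\<close> those with exactly
  one.\<close>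

lemma h_old: "bij_betw h (S2_old H \<alpha>) D"
proof (rule bij_betw_imageI)
  have Old_Cp: "v \<noteq> pendant u i"
    if v: "v \<in> r ` P" "v \<notin> leaves H" and u: "u \<in> leaves H" "1 \<le> i" "i \<le> \<alpha> u" for u v i
  proof
    assume "v = pendant u i"
    then have adj: "v \<in> D" "adj G v (support u)"
      using pendant_in[OF u(2,3)] by (simp_all add: pendants_def)
    obtain p where p: "p \<in> P" "v = r p"
      using v(1) by blast
    obtain p' where p': "p' \<noteq> p" "adj G (r p) p'"
      using nonleaf_two[OF p(1)] p(2) v(2) by metis
    have "q = support u" if "adj G v q" for q
      using leaf_pendant[OF support(1)[OF u(1)] _ adj that] support(2)[OF u(1)] u(1) by simp
    then show False
      using p p' r(2)[OF p(1)] by metis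
  qed
  have Cp_Cp: "u = v \<and> i = j" if "u \<in> leaves H" "1 \<le> i" "i \<le> \<alpha> u" "v \<in> leaves H" "1 \<le> j" "j \<le> \<alpha> v"
    "pendant u i = pendant v j" for u v i j
  proof -
    have "pendant u i \<in> D" "adj G (pendant u i) (support u)" "adj G (pendant u i) (support v)"
      using pendant_in[of i u] pendant_in[of j v] that by (simp_all add: pendants_def)
    then have "support v = support u"
      using leaf_pendant[of "support u" "pendant u i" "support v"] support[of u] that by simp
    then have "v = u"
      using support(2)[of u] support(2)[of v] that by simp
    then show ?thesis
      using pendant[of u] that by (auto simp: bij_betw_def inj_on_eq_iff)
  qed
  show "inj_on h (S2_old H \<alpha>)"
  proof (rule inj_onI)
    fix x y assume *: "x \<in> S2_old H \<alpha>" "y \<in> S2_old H \<alpha>" "h x = h y"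
    show "x = y"
    proof (cases x; cases y)
      fix v u i assume "x = Old v" "y = Cp u i"
      then show ?thesis
        using * Old_Cp[of v u i] by auto
    next
      fix v u i assume "x = Cp u i" "y = Old v"
      then show ?thesis
        using * Old_Cp[of v u i] by auto
    next
      fix u v i j assume "x = Cp u i" "y = Cp v j"
      then show ?thesis
        using * Cp_Cp[of u i v j] by auto
    qed (use * in simp_all)
  qed
  show "h ` S2_old H \<alpha> = D"
  proof
    show "h ` S2_old H \<alpha> \<subseteq> D"
    proof
      fix d assume "d \<in> h ` S2_old H \<alpha>"
      then obtain x where x: "x \<in> S2_old H \<alpha>" "d = h x"
        by blast
      then show "d \<in> D"
        using pendant_in r(1) by (cases x) (auto simp: pendants_def)
    qed
    show "D \<subseteq> h ` S2_old H \<alpha>"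
    proof
      fix d assume d: "d \<in> D"
      then obtain p where p: "p \<in> P" "adj G d p"
        using D_nbr by blast
      show "d \<in> h ` S2_old H \<alpha>"
      proof (cases "\<exists>p'. adj G d p' \<and> p' \<noteq> p")
        case True
        then obtain p' where p': "adj G d p'" "p' \<noteq> p"
          by blast
        then have "p' \<in> P" "r p = d" "r p' = d"
          using d p adj_D_P centre(2)[of d] by metis+
        then have "d \<notin> leaves H" "d \<in> verts H"
          using leaves_H_unique[of d p p'] p p' by auto
        then show ?thesis
          by (intro image_eqI[of _ _ "Old d"]) simp_all
      next
        case False
        then have leaf: "r p \<in> leaves H"
          using pendant_leaf[OF d p(2)] by blast
        then have "d \<in> pendants (r p)"
          using support_eqI p d by (simp add: pendants_def)
        then obtain i where "i \<in> {1..\<alpha> (r p)}" "d = pendant (r p) i"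
          using pendants_pendant by blast
        then show ?thesis
          using leaf by (intro image_eqI[of _ _ "Cp (r p) i"]) simp_all
      qed
    qed
  qed
qed

lemma S2_new_cases:
  assumes "x \<in> S2_new H"
  obtains e p where "x = Nw e (r p)" "e \<in> M" "card (ends H e) = 2" "p \<in> ends G e" "h x = p"
    | e where "x = Lp e 1" "e \<in> M" "card (ends H e) = 1" "h x = end1 e"
    | e where "x = Lp e 2" "e \<in> M" "card (ends H e) = 1" "h x = end2 e"
proof (cases x)
  case (Nw e u)
  then have e: "e \<in> M" "card (ends H e) = 2" "u \<in> r ` ends G e"
    using assms by simp_all
  then obtain p where "p \<in> ends G e" "u = r p"
    by blast
  then show ?thesis
    using that(1)[of e p] Nw e h_Nw by simp
next
  case (Lp e i)
  then show ?thesis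
    using assms that(2,3)[of e] by auto
qed (use assms in simp_all)

text \<open>\<open>h x\<close> lies on the matching edge that \<open>x\<close> names, and matching
  edges are disjoint, so injectivity need only be checked within one edge.\<close>

lemma h_new: "bij_betw h (S2_new H) P"
proof (rule bij_betw_imageI)
  show "inj_on h (S2_new H)"
  proof (rule inj_onI)
    fix x y assume *: "x \<in> S2_new H" "y \<in> S2_new H" "h x = h y"
    have edge: "\<exists>e\<in>M. h x \<in> ends G e \<and> x \<in> range (Nw e) \<union> range (Lp e)" if "x \<in> S2_new H" for x
      using that by (cases rule: S2_new_cases) (auto simp: ends_end12 simp del: h.simps)
    obtain e where e: "e \<in> M" "x \<in> range (Nw e) \<union> range (Lp e)" "y \<in> range (Nw e) \<union> range (Lp e)"
      using edge[OF *(1)] edge[OF *(2)] *(3) matching_edge_eqI by metis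
    from *(1) show "x = y"
    proof (cases rule: S2_new_cases)
      case (1 e1 p1)
      from *(2) show ?thesis
        by (cases rule: S2_new_cases) (use 1 e *(3) in \<open>auto simp del: h.simps\<close>)
    next
      case (2 e1)
      from *(2) show ?thesis
        by (cases rule: S2_new_cases) (use 2 e *(3) ends_end12(2)[OF e(1)] in \<open>auto simp del: h.simps\<close>)
    next
      case (3 e1)
      from *(2) show ?thesis
        by (cases rule: S2_new_cases) (use 3 e *(3) ends_end12(2)[OF e(1)] in \<open>auto simp del: h.simps\<close>)
    qed
  qed
  show "h ` S2_new H = P"
  proof
    show "h ` S2_new H \<subseteq> P"
    proof
      fix p assume "p \<in> h ` S2_new H"
      then obtain x where "x \<in> S2_new H" "p = h x"
        by blast
      then show "p \<in> P"
        by (cases rule: S2_new_cases) (auto simp: ends_end12 intro: M_in_P simp del: h.simps)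
    qed
    show "P \<subseteq> h ` S2_new H"
    proof
      fix p assume p: "p \<in> P"
      show "p \<in> h ` S2_new H"
      proof (cases "card (ends H (matching_edge p)) = 2")
        case True
        then show ?thesis
          using matching_edge[OF p] h_Nw[of "matching_edge p" p] by (intro image_eqI[of _ _ "Nw (matching_edge p) (r p)"]) simp_all
      next
        case False
        then have 1: "card (ends H (matching_edge p)) = 1"
          using card_H_ends matching_edge(1)[OF p] by blast
        have "p = end1 (matching_edge p) \<or> p = end2 (matching_edge p)"
          using ends_end12(1) matching_edge[OF p] by blast
        then show ?thesis
        proof
          assume "p = end1 (matching_edge p)"
          then show ?thesis
            using 1 matching_edge(1)[OF p] by (intro image_eqI[of _ _ "Lp (matching_edge p) 1"]) simp_all
        next
          assume "p = end2 (matching_edge p)"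
          then show ?thesis
            using 1 matching_edge(1)[OF p] by (intro image_eqI[of _ _ "Lp (matching_edge p) 2"]) simp_all
        qed
      qed
    qed
  qed
qed

lemma h_bij: "bij_betw h (verts (S2 H \<alpha>)) (verts G)"
  using bij_betw_combine[OF h_old h_new disjoint] verts_eq by simp

lemma h_Mid:
  assumes "e \<in> M"
  shows "h ` S2_ends H (Mid e) = ends G e"
proof (cases "card (ends H e) = 2")
  case True
  then have "h ` S2_ends H (Mid e) = (\<lambda>p. h (Nw e (r p))) ` ends G e"
    by (auto simp: image_image simp del: h.simps)
  also have "\<dots> = (\<lambda>p. p) ` ends G e"
    using h_Nw[OF assms True] by (intro image_cong) simp_all
  finally show ?thesis
    by simp
next
  case False
  then show ?thesis
    using ends_end12(1)[OF assms] by simp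
qed

lemma h_Att:
  assumes "e \<in> M" "card (ends H e) = 2" "p \<in> ends G e"
  shows "h ` S2_ends H (Att e (r p)) = {r p, p}"
  using h_Nw[OF assms] by (simp del: h.simps(3))

lemma h_LAtt:
  assumes "e \<in> M" "card (ends H e) = 1"
  shows "h ` S2_ends H (LAtt e 1) = {r (end1 e), end1 e}" "h ` S2_ends H (LAtt e 2) = {r (end2 e), end2 e}"
proof -
  obtain v where v: "r ` ends G e = {v}"
    using assms(2) card_1_singletonE by auto
  then have "r (end1 e) = v" "r (end2 e) = v"
    using ends_end12(1)[OF assms(1)] by blast+
  then show "h ` S2_ends H (LAtt e 1) = {r (end1 e), end1 e}" "h ` S2_ends H (LAtt e 2) = {r (end2 e), end2 e}"
    using v by simp_all
qed

lemma h_LfAtt: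
  assumes "v \<in> leaves H"
  shows "h ` S2_ends H (LfAtt v i) = {support v, pendant v i}"
proof -
  let ?e = "leaf_edge H v"
  have e: "?e \<in> M" "card (ends H ?e) = 2"
    using leaf_edge(1-3)[OF wf_H assms] by simp_all
  \<comment> \<open>The matching edge at the support contains \<open>v\<close> in \<open>H\<close>,
    and a leaf has only one edge.\<close>
  have "matching_edge (support v) = ?e"
    using leaf_edge_eqI[OF wf_H assms, of "matching_edge (support v)"] matching_edge[OF support(1)[OF assms]]
      imageI[OF matching_edge(2)[OF support(1)[OF assms]], of r] support(2)[OF assms] by simp
  then have "h (Nw ?e (r (support v))) = support v"
    using h_Nw[OF e] matching_edge(2)[OF support(1)[OF assms]] by simp
  then show ?thesis
    using support(2)[OF assms] by (simp del: h.simps(3))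
qed

lemma adj_ends: "adj G u v \<Longrightarrow> {u, v} \<in> ends G ` edges G"
  by (auto simp: adj_def image_iff)

text \<open>Middle edges correspond to \<open>M\<close>, all others to edges between some
  \<open>d\<close> in \<open>D\<close> and some \<open>p\<close> in \<open>P\<close>. A second
  neighbour of \<open>d\<close> makes it a centre and gives \<open>Att\<close> or
  \<open>LAtt\<close>; otherwise the edge is an \<open>LfAtt\<close>.\<close>

lemma h_edges: "(\<lambda>x. h ` ends (S2 H \<alpha>) x) ` edges (S2 H \<alpha>) = ends G ` edges G"
proof
  show "(\<lambda>x. h ` ends (S2 H \<alpha>) x) ` edges (S2 H \<alpha>) \<subseteq> ends G ` edges G"
  proof
    fix X assume "X \<in> (\<lambda>x. h ` ends (S2 H \<alpha>) x) ` edges (S2 H \<alpha>)"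
    then obtain x where x: "x \<in> edges (S2 H \<alpha>)" "X = h ` S2_ends H x"
      by auto
    have rp: "{r p, p} \<in> ends G ` edges G" if "p \<in> P" for p
      using r(2)[OF that] by (rule adj_ends)
    from x(1) show "X \<in> ends G ` edges G"
    proof (cases rule: S2_edge_cases)
      case (1 e)
      then show ?thesis
        using h_Mid x(2) M_edges by auto
    next
      case (2 e v)
      then obtain p where "p \<in> ends G e" "v = r p"
        by auto
      then show ?thesis
        using h_Att[of e p] x(2) 2 rp[of p] M_in_P[of e p] by simp
    next
      case (3 e i)
      have "end1 e \<in> P" "end2 e \<in> P"
        using M_in_P[of e] ends_end12(1)[of e] 3 by auto
      then show ?thesis
        using h_LAtt[of e] x(2) 3 rp by auto
    next
      case (4 v i)
      then have "adj G (support v) (pendant v i)"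
        using pendant_in[of i v] adj_commute[of G "pendant v i" "support v"] by (simp add: pendants_def)
      then show ?thesis
        using h_LfAtt[OF 4(2)] x(2) 4(1) adj_ends by simp
    qed
  qed
  show "ends G ` edges G \<subseteq> (\<lambda>x. h ` ends (S2 H \<alpha>) x) ` edges (S2 H \<alpha>)"
  proof
    have I: "X \<in> (\<lambda>x. h ` ends (S2 H \<alpha>) x) ` edges (S2 H \<alpha>)"
      if "x \<in> edges (S2 H \<alpha>)" "h ` S2_ends H x = X" for x X
      using that by (intro image_eqI[of _ _ x]) simp_all
    fix X assume "X \<in> ends G ` edges G"
    then obtain x where x: "x \<in> edges G" "X = ends G x"
      by blast
    from x(1) show "X \<in> (\<lambda>x. h ` ends (S2 H \<alpha>) x) ` edges (S2 H \<alpha>)"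
    proof (cases rule: edge_cases)
      case 1
      then show ?thesis
        using h_Mid[of x] x(2) by (intro I[of "Mid x"]) simp_all
    next
      case (2 d p)
      then have adj: "adj G d p"
        using x(1) by (auto simp: adj_def)
      have X: "X = {d, p}"
        using 2 x(2) by simp
      let ?e = "matching_edge p"
      note matching_edge = matching_edge[OF \<open>p \<in> P\<close>]
      show ?thesis
      proof (cases "\<exists>p'. adj G d p' \<and> p' \<noteq> p")
        case True
        then obtain p' where p': "adj G d p'" "p' \<noteq> p"
          by blast
        then have "p' \<in> P" and rp: "r p = d" and "r p' = d"
          using 2(1) adj adj_D_P centre(2)[of d] by metis+
        then have nonleaf: "d \<notin> leaves H"
          using leaves_H_unique[of d p p'] 2(2) p' by auto
        show ?thesis
        proof (cases "card (ends H ?e) = 2")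
          case True
          then show ?thesis
            using h_Att[OF matching_edge(1) True matching_edge(2)] rp X matching_edge nonleaf by (intro I[of "Att ?e d"]) auto
        next
          case False
          then have c1: "card (ends H ?e) = 1"
            using card_H_ends[OF matching_edge(1)] by blast
          have "p = end1 ?e \<or> p = end2 ?e"
            using ends_end12(1)[OF matching_edge(1)] matching_edge(2) by blast
          then show ?thesis
          proof
            assume "p = end1 ?e"
            then show ?thesis
              using h_LAtt(1)[OF matching_edge(1) c1] rp X matching_edge(1) c1 by (intro I[of "LAtt ?e 1"]) simp_all
          next
            assume "p = end2 ?e"
            then show ?thesis
              using h_LAtt(2)[OF matching_edge(1) c1] rp X matching_edge(1) c1 by (intro I[of "LAtt ?e 2"]) simp_all
          qed
        qed
      next
        case False
        then have leaf: "r p \<in> leaves H"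
          using pendant_leaf[OF 2(1) adj] by blast
        then have "d \<in> pendants (r p)" and support: "support (r p) = p"
          using support_eqI 2 adj by (simp_all add: pendants_def)
        then obtain i where i: "i \<in> {1..\<alpha> (r p)}" "d = pendant (r p) i"
          using pendants_pendant by blast
        then show ?thesis
          using h_LfAtt[OF leaf, of i] X support leaf by (intro I[of "LfAtt (r p) i"]) auto
      qed
    qed
  qed
qed

lemma h_iso: "\<exists>g. iso_map h g (S2 H \<alpha>) G"
  using h_bij h_edges S2_inj_ends[OF wf_H] inj_ends S2_ends_in_verts[OF wf_H]
  by (intro iso_map_simple)

lemma no_isolated_H: "no_isolated H"
  unfolding no_isolated_def
proof
  fix v assume "v \<in> verts H"
  then obtain p where p: "p \<in> P" "v = r p"
    by auto
  have fin: "finite (edges H)"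
    using wf_H by (simp add: wf_mgraph_def)
  have v: "v \<in> ends H (matching_edge p)" "matching_edge p \<in> edges H"
    using p matching_edge[OF p(1)] by auto
  let ?A = "{e \<in> edges H. v \<in> ends H e \<and> card (ends H e) = 2}"
  let ?B = "{e \<in> edges H. ends H e = {v}}"
  have "matching_edge p \<in> ?A \<or> matching_edge p \<in> ?B"
    using card_H_ends[OF matching_edge(1)[OF p(1)]]
  proof
    assume "card (ends H (matching_edge p)) = 1"
    then have "ends H (matching_edge p) = {v}"
      using v(1) by (metis card_1_singletonE singletonD)
    then show ?thesis
      using v(2) by simp
  next
    assume "card (ends H (matching_edge p)) = 2"
    then show ?thesis
      using v by simp
  qed
  then have "?A \<noteq> {} \<or> ?B \<noteq> {}"
    by blast
  moreover have "finite ?A" "finite ?B"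
    using fin by simp_all
  ultimately have "card ?A \<noteq> 0 \<or> card ?B \<noteq> 0"
    by (simp only: card_0_eq)
  then show "degree H v \<noteq> 0"
    unfolding degree_def by linarith
qed

text \<open>\<open>f\<close> contracts each star to its representative. Edges between
  \<open>D\<close> and \<open>P\<close> collapse and matching edges become edges of
  \<open>H\<close>, so walks in \<open>G\<close> project to walks in \<open>H\<close>.\<close>

lemma connected_H:
  assumes "connected G"
  shows "connected H"
proof -
  define nb where "nb d = (SOME p. p \<in> P \<and> adj G d p)" for d
  define f where "f x = (if x \<in> P then r x else r (nb x))" for x
  have nb: "nb d \<in> P" "adj G d (nb d)" if "d \<in> D" for d
    using someI_ex[of "\<lambda>p. p \<in> P \<and> adj G d p"] D_nbr[OF that] unfolding nb_def by blast+
  have f_D: "f d = r p" if "d \<in> D" "adj G d p" for d p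
  proof -
    \<comment> \<open>If \<open>d\<close> has two different neighbours, it is a centre and
      represents both, so the choice of \<open>nb d\<close> does not matter.\<close>
    have "r (nb d) = r p"
      using centre(2)[OF that(1), of p "nb d"] centre(2)[OF that(1), of "nb d" p] nb[OF that(1)] that
      by (cases "nb d = p") simp_all
    then show ?thesis
      using that(1) disjoint by (auto simp: f_def)
  qed
  have f_P: "f p = r p" if "p \<in> P" for p
    using that by (simp add: f_def)
  have step: "f x = f y \<or> adj H (f x) (f y)" if xy: "adj G x y" for x y
  proof -
    obtain e where e: "e \<in> edges G" "ends G e = {x, y}"
      using xy by (auto simp: adj_def)
    from e(1) show ?thesis
    proof (cases rule: edge_cases)
      case 1
      then have "x \<in> P" "y \<in> P"
        using M_in_P[of e] e(2) by simp_all
      then have "ends H e = {f x, f y}"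
        using e(2) f_P by simp
      then show ?thesis
        using 1 unfolding adj_def by auto
    next
      case (2 d p)
      then have "x = d \<and> y = p \<or> x = p \<and> y = d"
        using e(2) by (auto simp: doubleton_eq_iff)
      moreover have "adj G d p"
        using 2 e(1) by (auto simp: adj_def)
      then have "f d = f p"
        using f_D[OF 2(1)] f_P[OF 2(2)] by simp
      ultimately show ?thesis
        by metis
    qed
  qed
  have path: "(f x, f y) \<in> {(x, y). adj H x y}\<^sup>*" if "(x, y) \<in> {(x, y). adj G x y}\<^sup>*" for x y
    using that
  proof (induction rule: rtrancl_induct)
    case (step y z)
    then have "f y = f z \<or> adj H (f y) (f z)"
      using \<open>\<And>x y. adj G x y \<Longrightarrow> f x = f y \<or> adj H (f x) (f y)\<close> by blast
    then show ?case
      using step.IH by (auto intro: rtrancl_into_rtrancl)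
  qed simp
  show ?thesis
    unfolding connected_def
  proof (intro conjI ballI)
    obtain x where "x \<in> verts G"
      using assms by (auto simp: connected_def)
    then have "P \<noteq> {}"
      using verts_eq D_nbr by blast
    then show "verts H \<noteq> {}"
      by simp
    fix u v assume "u \<in> verts H" "v \<in> verts H"
    then obtain p q where "p \<in> P" "q \<in> P" "u = r p" "v = r q"
      by auto
    then show "(u, v) \<in> {(x, y). adj H x y}\<^sup>*"
      using path[of p q] f_P assms verts_eq by (simp add: connected_def)
  qed
qed

end

section \<open>Assembling the equivalence\<close>

lemma minimal_cycle_length:
  assumes "minimal_DPDP_graph (cycle_graph n)" "3 dvd n" "3 \<le> n"
  shows "n = 3 \<or> n = 6 \<or> n = 9"
proof -
  have "n < 12"
    using cycle_graph_not_minimal assms by force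
  obtain k where "n = 3 * k"
    using assms(2) by blast
  then show ?thesis
    using \<open>n < 12\<close> assms(3) by presburger
qed

text \<open>Pulling \<open>(D, P)\<close> back along \<open>h\<close> gives the pair of old and new
  vertices, by \<open>h_old\<close> and \<open>h_new\<close>; domination and matching need no check
  in the 2-subdivision graph itself.\<close>

lemma S2_of_minimal:
  fixes G :: "('v, 'e) mgraph"
  assumes wf: "wf_mgraph G" and conn: "connected G" and min: "minimal_DPDP_graph G"
  obtains H :: "('v, 'e) mgraph" and \<alpha> where "wf_mgraph H" "no_isolated H" "connected H"
    "\<forall>v\<in>leaves H. 1 \<le> \<alpha> v" "iso G (S2 H \<alpha>)" "DP_pair (S2 H \<alpha>) (S2_old H \<alpha>) (S2_new H)"
proof -
  obtain D P where DP: "DP_pair G D P"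
    using min by (auto simp: minimal_DPDP_graph_def DPDP_graph_def)
  obtain M where "minimal_DP G D P M"
    using minimal_DP_ex[OF wf min DP] .
  then interpret minimal_DP G D P M .
  obtain g where g: "iso_map h g (S2 H \<alpha>) G"
    using h_iso by blast
  let ?f = "inv_into (verts (S2 H \<alpha>)) h"
  note sym = iso_map_sym[OF g]
  have h: "inj_on h (verts (S2 H \<alpha>))"
    using h_bij by (simp add: bij_betw_def)
  have "?f ` h ` S2_old H \<alpha> = S2_old H \<alpha>" "?f ` h ` S2_new H = S2_new H"
    using h by (simp_all add: inv_into_image_cancel)
  then have "DP_pair (S2 H \<alpha>) (S2_old H \<alpha>) (S2_new H)"
    using iso_map_DP_pair[OF sym DP] h_old h_new by (simp add: bij_betw_def)
  moreover have "iso G (S2 H \<alpha>)"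
    using sym iso_iff_iso_map[OF wf_mgraph_ends[OF wf]] by blast
  ultimately show ?thesis
    using that wf_H no_isolated_H connected_H[OF conn] \<alpha>_pos by blast
qed

theorem theorem6p1:
  fixes G :: "('v, 'e) mgraph"
  assumes "wf_mgraph G" and "connected G" and "card (verts G) \<ge> 3"
  shows "minimal_DPDP_graph G \<longleftrightarrow>
    (\<exists>(H :: ('v, 'e) mgraph) (\<alpha> :: 'v \<Rightarrow> nat).
        wf_mgraph H \<and> no_isolated H \<and> connected H \<and> (\<forall>v\<in>leaves H. 1 \<le> \<alpha> v) \<and>
        iso G (S2 H \<alpha>) \<and>
        ((\<forall>D P. DP_pair (S2 H \<alpha>) D P \<longleftrightarrow> D = S2_old H \<alpha> \<and> P = S2_new H) \<or>
         is_cycle_of_length (S2 H \<alpha>) 3 \<or> is_cycle_of_length (S2 H \<alpha>) 6 \<or>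
         is_cycle_of_length (S2 H \<alpha>) 9))"
    (is "_ \<longleftrightarrow> (\<exists>H \<alpha>. ?S H \<alpha>)")
proof
  assume min: "minimal_DPDP_graph G"
  obtain H :: "('v, 'e) mgraph" and \<alpha> where H: "wf_mgraph H" "no_isolated H" "connected H"
    "\<forall>v\<in>leaves H. 1 \<le> \<alpha> v" and iso: "iso G (S2 H \<alpha>)"
    and DP: "DP_pair (S2 H \<alpha>) (S2_old H \<alpha>) (S2_new H)"
    using S2_of_minimal[OF assms(1,2) min] .
  obtain f g where fg: "iso_map f g G (S2 H \<alpha>)"
    using iso iso_iff_iso_map[OF wf_mgraph_ends[OF assms(1)]] by blast
  have wf2: "wf_mgraph (S2 H \<alpha>)" and conn2: "connected (S2 H \<alpha>)" and min2: "minimal_DPDP_graph (S2 H \<alpha>)"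
    using iso_map_wf[OF fg assms(1)] iso_map_connected[OF fg assms(2)] iso_map_minimal[OF fg min] .
  have "is_cycle_of_length (S2 H \<alpha>) 3 \<or> is_cycle_of_length (S2 H \<alpha>) 6 \<or> is_cycle_of_length (S2 H \<alpha>) 9"
    if not_unique: "\<not> (\<forall>D P. DP_pair (S2 H \<alpha>) D P \<longleftrightarrow> D = S2_old H \<alpha> \<and> P = S2_new H)"
  proof -
    obtain D P where D: "DP_pair (S2 H \<alpha>) D P" "\<not> (D = S2_old H \<alpha> \<and> P = S2_new H)"
      using not_unique DP by blast
    \<comment> \<open>The second set of a DP-pair is the complement of the first, so different pairs
      differ in their first sets.\<close>
    have compl: "P = verts (S2 H \<alpha>) - D" if "DP_pair (S2 H \<alpha>) D P" for D P
      using that unfolding DP_pair_def by blast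
    have "S2_old H \<alpha> \<noteq> D"
      using D(2) compl[OF D(1)] compl[OF DP] by metis
    then obtain n w k where n: "3 dvd n" "3 \<le> n" and w: "iso_map w k (cycle_graph n) (S2 H \<alpha>)"
      using distinct_DP_pairs_cycle[OF wf2 conn2 min2 DP D(1)] by metis
    have "minimal_DPDP_graph (cycle_graph n)"
      using iso_map_minimal[OF iso_map_sym[OF w] min2] .
    moreover have "is_cycle_of_length (S2 H \<alpha>) n"
      unfolding is_cycle_of_length_def
      using iso_map_sym[OF w] iso_iff_iso_map[OF wf_mgraph_ends[OF wf2]] n(2) by blast
    ultimately show ?thesis
      using minimal_cycle_length n by blast
  qed
  then have "?S H \<alpha>"
    using H iso by blast
  then show "\<exists>H \<alpha>. ?S H \<alpha>"
    by blast
next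
  assume "\<exists>H \<alpha>. ?S H \<alpha>"
  then obtain H :: "('v, 'e) mgraph" and \<alpha> :: "'v \<Rightarrow> nat" where H: "wf_mgraph H" "iso G (S2 H \<alpha>)"
    and cases: "(\<forall>D P. DP_pair (S2 H \<alpha>) D P \<longleftrightarrow> D = S2_old H \<alpha> \<and> P = S2_new H) \<or>
      (\<exists>n\<in>{3, 6, 9}. is_cycle_of_length (S2 H \<alpha>) n)"
    by blast
  obtain f g where "iso_map f g G (S2 H \<alpha>)"
    using H(2) iso_iff_iso_map[OF wf_mgraph_ends[OF assms(1)]] by blast
  then have "minimal_DPDP_graph G" if "minimal_DPDP_graph (S2 H \<alpha>)"
    using iso_map_minimal[OF iso_map_sym that] by blast
  moreover from cases have "minimal_DPDP_graph (S2 H \<alpha>)"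
  proof
    assume "\<forall>D P. DP_pair (S2 H \<alpha>) D P \<longleftrightarrow> D = S2_old H \<alpha> \<and> P = S2_new H"
    then show ?thesis
      by (intro S2_minimal[OF H(1)]) blast
  next
    assume "\<exists>n\<in>{3, 6, 9}. is_cycle_of_length (S2 H \<alpha>) n"
    then obtain n where n: "n \<in> {3, 6, 9}" "iso (S2 H \<alpha>) (cycle_graph n)"
      unfolding is_cycle_of_length_def by blast
    then obtain w k where "iso_map w k (S2 H \<alpha>) (cycle_graph n)"
      using iso_iff_iso_map[OF S2_ends_in_verts[OF H(1)]] by blast
    then show ?thesis
      using iso_map_minimal[OF iso_map_sym cycle_graph_minimal[OF n(1)]] by blast
  qed
  ultimately show "minimal_DPDP_graph G"
    by blast
qed

end
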